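(* Let $a_0,\dots,a_n\in\mathbb C$ with $a_0\ne 0$ and let $T=a_0I+a_1D+\cdots+a_nD^n$. Let $\gamma_1,\dots,\gamma_n$ be the roots of $a_0z^n+a_1z^{n-1}+\cdots+a_{n-1}z+a_n$, counted with multiplicity. Then $\deg(Tf)=\deg f$ for all $f\in\mathcal P_n$ and $$K_h(T)\le n\sum_{j=1}^n|\gamma_j|,\qquad K_H(T)\le n\sum_{j=1}^n|\gamma_j|,\qquad K_F(T)\le n^2\sum_{j=1}^n|\gamma_j|.$$
   Context: Let $n\ge 1$ be an integer and $\mathcal P_n$ the complex vector space of polynomials in one complex variable of degree at most $n$; $D$ is differentiation on $\mathcal P_n$ and $I$ the identity. For a nonzero $f\in\mathcal P_n$, $Z(f)$ denotes the multiset of roots of $f$ (each root listed according to its multiplicity; empty for nonzero constants); $Z(0)=\mathbb C$. Distances: for finite nonempty $A,B\subset\mathbb C$, $d_h(A,B)=\max_{y\in B}\min_{x\in A}|x-y|$, $d_H(A,B)=\max\{d_h(A,B),d_h(B,A)\}$. Conventions: for $d\in\{d_h,d_H\}$, $d(\emptyset,\emptyset)=0$, $d(A,\emptyset)=d(\emptyset,A)=+\infty$ for $A\ne\emptyset$, and $d(A,B)=0$ if one of $A,B$ equals $\mathbb C$ and the other is nonempty. For multisets $U=\{u_1,\dots,u_m\}$, $V=\{v_1,\dots,v_m\}$ of $m$ complex numbers, $d_F(U,V)=\min_{\sigma}\max_{k}|u_k-v_{\sigma(k)}|$, the minimum over permutations $\sigma$ of $\{1,\dots,m\}$. For $T$ a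 linear operator on $\mathcal P_n$: $K_h(T)=\sup_{f\in\mathcal P_n}d_h(Z(f),Z(Tf))$, $K_H(T)=\sup_{f\in\mathcal P_n}d_H(Z(f),Z(Tf))$; and, for $T$ with $\deg(Tf)=\deg f$ for all $f$, $K_F(T)=\sup\{d_F(Z(f),Z(Tf)): f\in\mathcal P_n\text{ nonconstant}\}$. *)

theory Defs
  imports "HOL-Analysis.Analysis" "HOL-Computational_Algebra.Computational_Algebra"
begin

text \<open>Zero set Z(f) as a set: for f = 0 this is all of C, for a nonzero constant it is empty.\<close>
definition Zset :: "complex poly \<Rightarrow> complex set" where
  "Zset f = {z. poly f z = 0}"

definition Top :: "nat \<Rightarrow> (nat \<Rightarrow> complex) \<Rightarrow> complex poly \<Rightarrow> complex poly" where
  "Top n a f = (\<Sum>k\<le>n. smult (a k) ((pderiv ^^ k) f))"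

definition dh :: "complex set \<Rightarrow> complex set \<Rightarrow> ereal" where
  "dh A B =
     (if A = {} \<and> B = {} then 0
      else if A = {} \<or> B = {} then \<infinity>
      else if A = UNIV \<or> B = UNIV then 0
      else ereal (Max ((\<lambda>y. Min ((\<lambda>x. cmod (x - y)) ` A)) ` B)))"

definition dHH :: "complex set \<Rightarrow> complex set \<Rightarrow> ereal" where
  "dHH A B = max (dh A B) (dh B A)"

text \<open>Optimal-matching distance between multisets of equal size m:
  min over permutations sigma of max_k |u_k - v_sigma(k)|, where u_1..u_m
  is a fixed enumeration of U.\<close>
definition dF :: "complex multiset \<Rightarrow> complex multiset \<Rightarrow> real" where
  "dF U V = (let us = SOME us. mset us = U; m = size U in
     Min {Max ((\<lambda>k. cmod (us ! k - vs ! k)) ` {..<m}) | vs. mset vs = V})"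

definition Kh :: "nat \<Rightarrow> (complex poly \<Rightarrow> complex poly) \<Rightarrow> ereal" where
  "Kh n T = (SUP f \<in> {f. degree f \<le> n}. dh (Zset f) (Zset (T f)))"

definition KH :: "nat \<Rightarrow> (complex poly \<Rightarrow> complex poly) \<Rightarrow> ereal" where
  "KH n T = (SUP f \<in> {f. degree f \<le> n}. dHH (Zset f) (Zset (T f)))"

definition KF :: "nat \<Rightarrow> (complex poly \<Rightarrow> complex poly) \<Rightarrow> ereal" where
  "KF n T = (SUP f \<in> {f. degree f \<le> n \<and> degree f \<ge> 1}.
               ereal (dF (proots f) (proots (T f))))"

end

theory Submission
  imports Defs
begin

text \<open>Since \<open>T = a\<^sub>0 \<Prod>(I - \<gamma>\<^sub>j D)\<close>, it suffices to control one factor. If \<open>f = \<gamma> f'\<close> at \<open>y\<close>, the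
  logarithmic derivative gives a root of \<open>f\<close> within \<open>n \<bar>\<gamma>\<bar>\<close> of \<open>y\<close>. Conversely
  \<open>f = \<Sum> \<gamma>\<^sup>k g\<^sup>(\<^sup>k\<^sup>)\<close> for \<open>g = f - \<gamma> f'\<close>; if \<open>f x = 0\<close> while \<open>g\<close> has no root within \<open>n \<bar>\<gamma>\<bar>\<close>
  of \<open>x\<close>, Walsh's coincidence theorem reduces to the case where all roots of \<open>g\<close> coincide, and this
  contradicts Enestrom--Kakeya for the truncated exponential series. Hence \<open>T\<close> and its inverse move
  the roots by at most \<open>S = n \<Sum> \<bar>\<gamma>\<^sub>j\<bar>\<close> in the one-sided Hausdorff sense.

  For the matching distance, join \<open>f\<close> to \<open>T f\<close> by replacing \<open>\<gamma>\<^sub>j\<close> by \<open>t \<gamma>\<^sub>j\<close>, and \<open>T f\<close> to \<open>f\<close>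
  likewise with the inverse factors. If no matching within \<open>n S\<close> existed, Hall's theorem would give
  sets \<open>A\<close> and \<open>B\<close> of roots of \<open>f\<close> and \<open>T f\<close> at distance more than \<open>n S\<close> with more than \<open>n\<close> elements
  together; starting from the larger of the two, its path keeps constant the number of roots in a
  suitable neighbourhood of it, leaving too little room for the other set. Using both paths is what yields the factor \<open>n\<close>
  rather than \<open>2 n - 1\<close>.\<close>

section \<open>The factors of the operator\<close>

lemma pderiv_prod_roots:
  fixes r :: "nat \<Rightarrow> complex"
  assumes "\<And>i. i < d \<Longrightarrow> y \<noteq> r i"
  shows "poly (pderiv (\<Prod>i<d. [:- r i, 1:])) y
    = poly (\<Prod>i<d. [:- r i, 1:]) y * (\<Sum>i<d. 1 / (y - r i))"
  using assms
proof (induction d)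
  case (Suc d)
  then have nz: "y - r d \<noteq> 0" by auto
  define P where "P = (\<Prod>i<d. [:- r i, 1:])"
  define S where "S = (\<Sum>i<d. 1 / (y - r i))"
  have IH: "poly (pderiv P) y = poly P y * S" using Suc unfolding P_def S_def by auto
  have "poly (pderiv (P * [:- r d, 1:])) y = poly P y + poly (pderiv P) y * (y - r d)"
    by (simp only: pderiv_mult poly_add poly_mult) (simp add: pderiv_pCons)
  also have "\<dots> = poly (P * [:- r d, 1:]) y * (S + 1 / (y - r d))"
    using nz unfolding IH poly_mult by (simp add: field_simps)
  finally show ?case by (simp only: P_def S_def prod.lessThan_Suc sum.lessThan_Suc)
qed simp

text \<open>Indexing by \<open>i < degree p\<close> lists each root as often as its multiplicity, so
  the sum has exactly \<open>degree p\<close> terms; both uses below depend on that count.\<close>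

lemma log_deriv_roots:
  fixes p :: "complex poly"
  obtains r where "\<And>i. i < degree p \<Longrightarrow> poly p (r i) = 0"
    "\<And>y. poly p y \<noteq> 0 \<Longrightarrow>
       poly (pderiv p) y = poly p y * (\<Sum>i<degree p. 1 / (y - r i))"
proof (cases "p = 0")
  case True
  then show ?thesis using that[of "\<lambda>_. 0"] by auto
next
  case False
  obtain r where r: "smult (lead_coeff p) (\<Prod>i<degree p. [:- r i, 1:]) = p"
    by (rule complex_poly_decompose')
  define P where "P = (\<Prod>i<degree p. [:- r i, 1:])"
  have p: "p = smult (lead_coeff p) P" using r by (simp add: P_def)
  have root: "poly p (r i) = 0" if "i < degree p" for i
  proof -
    have "poly P (r i) = 0" unfolding P_def poly_prod using that by (auto intro!: prod_zero)
    then show ?thesis by (subst p) simp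
  qed
  have "poly (pderiv p) y = poly p y * (\<Sum>i<degree p. 1 / (y - r i))"
    if "poly p y \<noteq> 0" for y
  proof -
    have "poly (pderiv P) y = poly P y * (\<Sum>i<degree p. 1 / (y - r i))"
      unfolding P_def by (rule pderiv_prod_roots) (use that root in auto)
    moreover have "poly (pderiv p) y = lead_coeff p * poly (pderiv P) y"
      by (subst p) (simp add: pderiv_smult)
    moreover have "poly p y = lead_coeff p * poly P y" by (subst p) simp
    ultimately show ?thesis by simp
  qed
  with root show ?thesis using that by blast
qed

section \<open>Algebra of \<open>I - \<gamma> D\<close> and its inverse\<close>

definition id_minus_deriv :: "complex \<Rightarrow> complex poly \<Rightarrow> complex poly" where
  "id_minus_deriv \<gamma> f = f - smult \<gamma> (pderiv f)"

text \<open>The Neumann series of the inverse of \<open>I - \<gamma> D\<close>, finite because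
  \<open>D\<close> is nilpotent on polynomials of bounded degree. Cutting at \<open>degree f\<close>
  makes it independent of \<open>n\<close>.\<close>

definition inv_id_minus_deriv :: "complex \<Rightarrow> complex poly \<Rightarrow> complex poly" where
  "inv_id_minus_deriv \<gamma> f = (\<Sum>k\<le>degree f. smult (\<gamma> ^ k) ((pderiv ^^ k) f))"

lemma higher_pderiv_eq_0:
  fixes f :: "complex poly"
  assumes "degree f < k"
  shows "(pderiv ^^ k) f = 0"
  using assms by (intro poly_eqI) (simp add: coeff_higher_pderiv coeff_eq_0)

text \<open>A summation range that does not depend on \<open>f\<close> makes continuity of the
  coefficients along a path of polynomials visible.\<close>

lemma inv_id_minus_deriv_ge:
  assumes "degree f \<le> m"
  shows "inv_id_minus_deriv \<gamma> f = (\<Sum>k\<le>m. smult (\<gamma> ^ k) ((pderiv ^^ k) f))"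
  unfolding inv_id_minus_deriv_def
  by (rule sum.mono_neutral_left) (use assms in \<open>auto simp: higher_pderiv_eq_0\<close>)

lemma coeff_id_minus_deriv:
  "coeff (id_minus_deriv \<gamma> f) i = coeff f i - \<gamma> * of_nat (Suc i) * coeff f (Suc i)"
  by (simp add: id_minus_deriv_def coeff_pderiv)

lemma degree_id_minus_deriv [simp]: "degree (id_minus_deriv \<gamma> f) = degree f"
proof (rule antisym)
  show "degree (id_minus_deriv \<gamma> f) \<le> degree f"
    by (rule degree_le) (auto simp: coeff_id_minus_deriv coeff_eq_0)
  show "degree f \<le> degree (id_minus_deriv \<gamma> f)"
    by (cases "f = 0") (auto intro: le_degree simp: coeff_id_minus_deriv coeff_eq_0)
qed

lemma coeff_inv_id_minus_deriv:
  assumes "degree f \<le> m"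
  shows "coeff (inv_id_minus_deriv \<gamma> f) i
    = (\<Sum>k\<le>m. \<gamma> ^ k * (pochhammer (of_nat (Suc i)) k * coeff f (i + k)))"
  unfolding inv_id_minus_deriv_ge[OF assms] coeff_sum
  by (simp add: coeff_higher_pderiv)

lemma lead_coeff_inv_id_minus_deriv:
  "coeff (inv_id_minus_deriv \<gamma> f) (degree f) = lead_coeff f"
proof -
  have "(\<Sum>k\<le>degree f. \<gamma> ^ k * (pochhammer (of_nat (Suc (degree f))) k * coeff f (degree f + k)))
      = (\<Sum>k\<in>{0}. \<gamma> ^ k * (pochhammer (of_nat (Suc (degree f))) k * coeff f (degree f + k)))"
    by (rule sum.mono_neutral_right) (auto simp: coeff_eq_0)
  then show ?thesis by (simp add: coeff_inv_id_minus_deriv[OF order_refl])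
qed

lemma degree_inv_id_minus_deriv [simp]: "degree (inv_id_minus_deriv \<gamma> f) = degree f"
proof (rule antisym)
  show "degree (inv_id_minus_deriv \<gamma> f) \<le> degree f"
    by (rule degree_le) (auto simp: coeff_inv_id_minus_deriv[OF order_refl] coeff_eq_0)
  show "degree f \<le> degree (inv_id_minus_deriv \<gamma> f)"
    by (cases "f = 0") (auto intro: le_degree simp: lead_coeff_inv_id_minus_deriv)
qed

lemma id_minus_deriv_eq_0_iff [simp]: "id_minus_deriv \<gamma> f = 0 \<longleftrightarrow> f = 0"
proof
  assume "id_minus_deriv \<gamma> f = 0"
  then have "coeff (id_minus_deriv \<gamma> f) (degree f) = 0" by simp
  then show "f = 0" by (simp add: coeff_id_minus_deriv coeff_eq_0)
qed (simp add: id_minus_deriv_def)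

lemma smult_sum_right: "smult c (\<Sum>i\<in>A. f i) = (\<Sum>i\<in>A. smult c (f i))"
  by (induction A rule: infinite_finite_induct) (simp_all add: smult_add_right)

lemma pderiv_sum: "pderiv (\<Sum>i\<in>A. f i) = (\<Sum>i\<in>A. pderiv (f i))"
  by (induction A rule: infinite_finite_induct) (simp_all add: pderiv_add)

lemma higher_pderiv_diff:
  fixes f g :: "complex poly"
  shows "(pderiv ^^ k) (f - g) = (pderiv ^^ k) f - (pderiv ^^ k) g"
  using higher_pderiv_add[of k "f - g" g] by (simp add: algebra_simps)

text \<open>Applied to \<open>f - \<gamma> f'\<close> the series telescopes; the end term is a
  derivative of order \<open>degree f + 1\<close> and vanishes.\<close>

lemma inv_id_minus_deriv_id_minus_deriv:
  "inv_id_minus_deriv \<gamma> (id_minus_deriv \<gamma> f) = f"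
proof -
  let ?t = "\<lambda>k. smult (\<gamma> ^ k) ((pderiv ^^ k) f)"
  have "inv_id_minus_deriv \<gamma> (id_minus_deriv \<gamma> f)
      = (\<Sum>k\<le>degree f. smult (\<gamma> ^ k) ((pderiv ^^ k) (f - smult \<gamma> (pderiv f))))"
    unfolding inv_id_minus_deriv_def degree_id_minus_deriv by (simp add: id_minus_deriv_def)
  also have "\<dots> = (\<Sum>k\<le>degree f. ?t k - ?t (Suc k))"
    by (intro sum.cong refl)
      (simp add: higher_pderiv_diff higher_pderiv_smult smult_diff_right funpow_swap1 mult_ac)
  also have "\<dots> = ?t 0 - ?t (Suc (degree f))"
    by (rule sum_telescope)
  finally show ?thesis by (simp add: higher_pderiv_eq_0 del: funpow.simps(2))
qed

lemma id_minus_deriv_inv_id_minus_deriv: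
  "id_minus_deriv \<gamma> (inv_id_minus_deriv \<gamma> f) = f"
proof -
  let ?t = "\<lambda>k. smult (\<gamma> ^ k) ((pderiv ^^ k) f)"
  have "id_minus_deriv \<gamma> (inv_id_minus_deriv \<gamma> f) = (\<Sum>k\<le>degree f. ?t k - ?t (Suc k))"
    unfolding inv_id_minus_deriv_def id_minus_deriv_def
    by (simp add: sum_subtractf pderiv_smult smult_sum_right pderiv_sum)
  also have "\<dots> = ?t 0 - ?t (Suc (degree f))"
    by (rule sum_telescope)
  finally show ?thesis by (simp add: higher_pderiv_eq_0 del: funpow.simps(2))
qed

text \<open>If \<open>f\<close> does not vanish at \<open>y\<close>, dividing by its value leaves
  \<open>1 = \<gamma> * (\<Sum>i<m. 1 / (y - r i))\<close> with \<open>m = degree f\<close>. Were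
  every root farther away than \<open>m |\<gamma>|\<close>, each of the \<open>m\<close> terms would
  be smaller than \<open>1 / (m |\<gamma>|)\<close> and the right side would have modulus below
  1.\<close>

lemma id_minus_deriv_root_near:
  assumes "degree f \<ge> 1" and "poly (id_minus_deriv \<gamma> f) y = 0"
  obtains x where "poly f x = 0" "cmod (x - y) \<le> real (degree f) * cmod \<gamma>"
proof (cases "poly f y = 0")
  case True
  then show ?thesis using that[of y] by simp
next
  case False
  let ?m = "degree f"
  obtain r where r: "\<And>i. i < ?m \<Longrightarrow> poly f (r i) = 0"
    and d: "poly (pderiv f) y = poly f y * (\<Sum>i<?m. 1 / (y - r i))"
    using log_deriv_roots[of f] False by metis
  have one: "1 = \<gamma> * (\<Sum>i<?m. 1 / (y - r i))"
    using assms(2) d False by (simp add: id_minus_deriv_def)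
  show ?thesis
  proof (rule ccontr)
    assume "\<not> thesis"
    with that have "\<And>x. poly f x = 0 \<Longrightarrow> real ?m * cmod \<gamma> < cmod (y - x)"
      by (force simp: norm_minus_commute not_le)
    then have far: "real ?m * cmod \<gamma> < cmod (y - r i)" if "i < ?m" for i
      using r that by blast
    have \<gamma>: "cmod \<gamma> > 0" using one by auto
    have m0: "0 < real ?m * cmod \<gamma>" using assms(1) \<gamma> by simp
    have lt: "cmod (1 / (y - r i)) < 1 / (real ?m * cmod \<gamma>)" if "i < ?m" for i
      using far[OF that] m0 by (simp add: norm_divide frac_less2)
    have "1 = cmod \<gamma> * cmod (\<Sum>i<?m. 1 / (y - r i))"
      using arg_cong[OF one, of cmod] by (simp add: norm_mult)
    also have "\<dots> \<le> cmod \<gamma> * (\<Sum>i<?m. cmod (1 / (y - r i)))"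
      by (intro mult_left_mono norm_sum) auto
    also have "\<dots> < cmod \<gamma> * (\<Sum>i<?m. 1 / (real ?m * cmod \<gamma>))"
      using assms(1) \<gamma> lt by (intro mult_strict_left_mono sum_strict_mono) (auto simp: lessThan_empty_iff)
    also have "\<dots> = 1" using assms(1) \<gamma> by simp
    finally show False by simp
  qed
qed

section \<open>Coincidence of roots\<close>

text \<open>Laguerre's theorem for the polar derivative with pole \<open>z\<close>. The formal
  degree \<open>m\<close> may exceed \<open>degree p\<close>, because the polynomials arising in
  Walsh's theorem may have vanishing top coefficients.\<close>

lemma laguerre_polar_nonzero:
  fixes p :: "complex poly"
  assumes deg: "degree p \<le> m" and m: "m \<ge> 1"
    and nz: "\<And>v. cmod v < \<rho> \<Longrightarrow> poly p v \<noteq> 0"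
    and z: "cmod z < \<rho>" and u: "cmod u < \<rho>"
  shows "of_nat m * poly p u + (z - u) * poly (pderiv p) u \<noteq> 0"
proof
  assume 0: "of_nat m * poly p u + (z - u) * poly (pderiv p) u = 0"
  let ?d = "degree p"
  obtain r where r: "\<And>i. i < ?d \<Longrightarrow> poly p (r i) = 0"
    and d: "poly (pderiv p) u = poly p u * (\<Sum>i<?d. 1 / (u - r i))"
    using log_deriv_roots[of p] nz[OF u] by metis
  define c where "c = \<rho>\<^sup>2 - (cmod u)\<^sup>2"
  have "(cmod u)\<^sup>2 < \<rho>\<^sup>2" using u by (intro power_strict_mono) auto
  then have c: "c > 0" by (simp add: c_def)
  \<comment> \<open>\<open>F\<close> is concave and \<open>F s \<ge> 0\<close> says that \<open>w = u + 1 / s\<close> lies outside the disc of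
    radius \<open>\<rho>\<close>; roots contribute \<open>F \<ge> 0\<close>, the missing \<open>m - degree p\<close> roots at infinity
    contribute \<open>F 0 = 1\<close>, but the average of all \<open>m\<close> points would be \<open>1 / (z - u)\<close>, where \<open>F < 0\<close>.\<close>
  define F where "F s = 1 + 2 * Re (u * s) - c * (cmod s)\<^sup>2" for s
  have F: "(cmod (w - u))\<^sup>2 * F (1 / (w - u)) = (cmod w)\<^sup>2 - \<rho>\<^sup>2" if "w \<noteq> u" for w
  proof -
    define h where "h = w - u"
    have h: "h \<noteq> 0" and w: "w = u + h" using that by (auto simp: h_def)
    have "(cmod h)\<^sup>2 * Re (u / h) = Re (u * cnj h)"
      using h by (simp add: complex_div_cnj[of u h] del: complex_mult_cnj)
    moreover have "(cmod (u + h))\<^sup>2 = (cmod u)\<^sup>2 + (cmod h)\<^sup>2 + 2 * Re (u * cnj h)"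
      unfolding cmod_power2 by (simp add: power2_eq_square algebra_simps)
    ultimately show ?thesis
      using h unfolding F_def c_def h_def[symmetric] w
      by (simp add: norm_divide power_divide field_simps)
  qed
  define s where "s i = 1 / (r i - u)" for i
  define \<sigma> where "\<sigma> = (\<Sum>i<?d. s i)"
  have \<sigma>: "(\<Sum>i<?d. 1 / (u - r i)) = - \<sigma>"
    unfolding \<sigma>_def s_def sum_negf[symmetric]
    by (intro sum.cong refl) (metis divide_minus_right minus_diff_eq)
  have eq: "of_nat m = (z - u) * \<sigma>"
  proof -
    have "poly p u * (of_nat m - (z - u) * \<sigma>) = 0"
      using 0 unfolding d \<sigma> by (simp add: algebra_simps)
    then show ?thesis using nz[OF u] by simp
  qed
  then have zu: "z \<noteq> u" using m by auto
  then have \<sigma>m: "\<sigma> = of_nat m * (1 / (z - u))" using eq by (simp add: field_simps)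
  have "(cmod (z - u))\<^sup>2 * F (1 / (z - u)) < 0"
    unfolding F[OF zu] using z by (auto intro: power_strict_mono)
  then have neg: "F (1 / (z - u)) < 0"
    using zu by (simp add: mult_less_0_iff)
  have pos: "F (s i) \<ge> 0" if "i < ?d" for i
  proof -
    have "\<not> cmod (r i) < \<rho>" using r[OF that] nz by blast
    moreover have "0 \<le> \<rho>" using u by (meson norm_ge_zero order.strict_implies_order order_le_less_trans)
    ultimately have "(cmod (r i))\<^sup>2 - \<rho>\<^sup>2 \<ge> 0" by (simp add: power_mono)
    moreover have "r i \<noteq> u" using r[OF that] nz[OF u] by auto
    ultimately have "0 \<le> (cmod (r i - u))\<^sup>2 * F (s i)" and "(cmod (r i - u))\<^sup>2 > 0"
      unfolding s_def using F[of "r i"] by auto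
    then show ?thesis by (simp only: zero_le_mult_iff) auto
  qed
  have "0 \<le> (\<Sum>i<?d. F (s i))" by (intro sum_nonneg) (use pos in auto)
  also have "\<dots> = real ?d + 2 * Re (u * \<sigma>) - c * (\<Sum>i<?d. (cmod (s i))\<^sup>2)"
    unfolding F_def \<sigma>_def by (simp add: sum.distrib sum_subtractf sum_distrib_left)
  \<comment> \<open>Replacing \<open>degree p\<close> by \<open>m\<close> accounts for the roots at
    infinity, each contributing \<open>F 0 = 1\<close>.\<close>
  finally have s1: "c * (\<Sum>i<?d. (cmod (s i))\<^sup>2) \<le> real m + 2 * Re (u * \<sigma>)" using deg by linarith
  \<comment> \<open>Cauchy-Schwarz on the quadratic part supplies the concavity of \<open>F\<close>:
    it makes \<open>F\<close> nonnegative at the average \<open>\<sigma> / m = 1 / (z - u)\<close>,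
    contradicting \<open>neg\<close>.\<close>
  have "(cmod \<sigma>)\<^sup>2 \<le> (\<Sum>i<?d. cmod (s i))\<^sup>2"
    unfolding \<sigma>_def by (intro power_mono norm_sum) auto
  also have "\<dots> \<le> real m * (\<Sum>i<?d. (cmod (s i))\<^sup>2)"
    using sum_squared_le_sum_of_squares[of "\<lambda>i. cmod (s i)" "{..<?d}"] deg
    by (auto elim!: order_trans intro!: mult_right_mono sum_nonneg simp: mult.commute)
  finally have "c * (cmod \<sigma>)\<^sup>2 \<le> real m * (c * (\<Sum>i<?d. (cmod (s i))\<^sup>2))"
    using c by (simp add: mult.left_commute)
  also have "\<dots> \<le> real m * (real m + 2 * Re (u * \<sigma>))"
    using s1 by (intro mult_left_mono) auto
  finally have "0 \<le> real m * (real m + 2 * Re (u * \<sigma>)) - c * (cmod \<sigma>)\<^sup>2" by simp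
  also have "\<dots> = (real m)\<^sup>2 * F (1 / (z - u))"
  proof -
    have "Re (u * (of_nat m * w)) = real m * Re (u * w)" for w
      by (simp add: algebra_simps)
    from this[of "1 / (z - u)"]
    have "Re (u * (of_nat m * (1 / (z - u)))) = real m * Re (u * (1 / (z - u)))" .
    moreover have "cmod (of_nat m * (1 / (z - u))) = real m * cmod (1 / (z - u))"
      by (simp only: norm_mult norm_of_nat)
    ultimately show ?thesis
      unfolding \<sigma>m F_def by (simp only:) (simp only: power2_eq_square algebra_simps)
  qed
  finally show False using neg m by (simp add: zero_le_mult_iff)
qed

lemma degree_prod_list_linear_le:
  "degree (\<Prod>u\<leftarrow>us. [:1, - u :: complex:]) \<le> length us"
proof (induction us)
  case (Cons u us)
  have "degree ([:1, - u:] * (\<Prod>u\<leftarrow>us. [:1, - u:])) \<le> 1 + length us"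
    by (rule order_trans[OF degree_mult_le]) (use Cons in \<open>auto intro!: add_mono\<close>)
  then show ?case by simp
qed simp

text \<open>Binomial weights turn the polar derivative into a shift of coefficients, which an
  induction on the number of roots can iterate. \<open>A\<close> treats \<open>p'\<close> and
  \<open>B\<close> treats \<open>(m + 1) p - v p'\<close>; each rests on an absorption identity for
  binomial coefficients.\<close>

lemma polar_binomial_sum:
  fixes e :: "nat \<Rightarrow> complex" and m :: nat
  defines "p \<equiv> \<Sum>k\<le>Suc m. monom (of_nat (Suc m choose k) * e k) k"
  shows "of_nat (Suc m) * poly p v + (u - v) * poly (pderiv p) v
    = of_nat (Suc m) * (\<Sum>k\<le>m. of_nat (m choose k) * (e k + u * e (Suc k)) * v ^ k)"
proof -
  have p: "poly p v = (\<Sum>k\<le>Suc m. of_nat (Suc m choose k) * e k * v ^ k)"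
    by (simp add: p_def poly_sum poly_monom)
  have dp: "pderiv p = (\<Sum>k\<le>Suc m. monom (of_nat k * (of_nat (Suc m choose k) * e k)) (k - 1))"
    unfolding p_def by (simp only: pderiv_sum pderiv_monom)
  have dp1: "poly (pderiv p) v
      = (\<Sum>k\<le>Suc m. of_nat k * (of_nat (Suc m choose k) * e k) * v ^ (k - 1))"
    unfolding dp by (simp add: poly_sum poly_monom)
  also have "\<dots> = (\<Sum>k\<le>m. of_nat (Suc k * (Suc m choose Suc k)) * e (Suc k) * v ^ k)"
    unfolding sum.atMost_Suc_shift of_nat_mult by (simp del: binomial_Suc_Suc of_nat_Suc add: mult.assoc)
  also have "\<dots> = (\<Sum>k\<le>m. of_nat (Suc m * (m choose k)) * e (Suc k) * v ^ k)"
    by (simp only: Suc_times_binomial)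
  finally have A: "poly (pderiv p) v = of_nat (Suc m) * (\<Sum>k\<le>m. of_nat (m choose k) * e (Suc k) * v ^ k)"
    by (simp only: sum_distrib_left of_nat_mult mult.assoc)
  have "v * poly (pderiv p) v = (\<Sum>k\<le>Suc m. of_nat k * (of_nat (Suc m choose k) * e k) * v ^ k)"
    unfolding dp1 sum_distrib_left
  proof (intro sum.cong refl)
    fix k show "v * (of_nat k * (of_nat (Suc m choose k) * e k) * v ^ (k - 1))
       = of_nat k * (of_nat (Suc m choose k) * e k) * v ^ k"
      by (cases k) (simp_all del: binomial_Suc_Suc)
  qed
  then have "of_nat (Suc m) * poly p v - v * poly (pderiv p) v
      = (\<Sum>k\<le>Suc m. (of_nat (Suc m) - of_nat k) * of_nat (Suc m choose k) * e k * v ^ k)"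
    unfolding p by (simp only: sum_distrib_left sum_subtractf[symmetric])
      (simp only: algebra_simps)
  also have "\<dots> = (\<Sum>k\<le>Suc m. of_nat (Suc m * (m choose k)) * e k * v ^ k)"
  proof (intro sum.cong refl)
    fix k assume "k \<in> {..Suc m}"
    then have "(of_nat (Suc m) - of_nat k :: complex) = of_nat (Suc m - k)"
      by (simp only: of_nat_diff atMost_iff)
    moreover have "(Suc m - k) * (Suc m choose k) = Suc m * (m choose k)"
      using binomial_absorb_comp[of "Suc m" k] by simp
    ultimately show "(of_nat (Suc m) - of_nat k) * of_nat (Suc m choose k) * e k * v ^ k
        = of_nat (Suc m * (m choose k)) * e k * v ^ k"
      by (metis of_nat_mult)
  qed
  \<comment> \<open>The term \<open>k = Suc m\<close> disappears because
    \<open>m choose Suc m = 0\<close>.\<close>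
  also have "\<dots> = of_nat (Suc m) * (\<Sum>k\<le>m. of_nat (m choose k) * e k * v ^ k)"
    by (subst sum.atMost_Suc)
      (simp only: sum_distrib_left of_nat_mult mult.assoc, simp)
  finally have B: "of_nat (Suc m) * poly p v - v * poly (pderiv p) v
     = of_nat (Suc m) * (\<Sum>k\<le>m. of_nat (m choose k) * e k * v ^ k)" .
  have "of_nat (Suc m) * poly p v + (u - v) * poly (pderiv p) v
     = (of_nat (Suc m) * poly p v - v * poly (pderiv p) v) + u * poly (pderiv p) v"
    by (simp only: algebra_simps)
  also have "\<dots> = of_nat (Suc m) * ((\<Sum>k\<le>m. of_nat (m choose k) * e k * v ^ k)
      + u * (\<Sum>k\<le>m. of_nat (m choose k) * e (Suc k) * v ^ k))"
    unfolding B unfolding A by (simp only: algebra_simps)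
  also have "(\<Sum>k\<le>m. of_nat (m choose k) * e k * v ^ k)
      + u * (\<Sum>k\<le>m. of_nat (m choose k) * e (Suc k) * v ^ k)
      = (\<Sum>k\<le>m. of_nat (m choose k) * (e k + u * e (Suc k)) * v ^ k)"
    unfolding sum_distrib_left sum.distrib[symmetric]
    by (intro sum.cong refl) (simp only: algebra_simps)
  finally show ?thesis .
qed

text \<open>Grace--Walsh--Szego in the form needed: \<open>d\<close> is the functional \<open>g \<mapsto> \<Sum> d k * coeff g k\<close>,
  and the hypothesis is its value on \<open>(1 - v z)\<^sup>m\<close>. Splitting off the factor \<open>1 - u z\<close> replaces
  \<open>d k\<close> by \<open>d k - u * d (k + 1)\<close>, which is the polar derivative on the side of the hypothesis.\<close>
lemma walsh_coincidence_nonzero: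
  fixes d :: "nat \<Rightarrow> complex"
  assumes "\<And>u. u \<in> set us \<Longrightarrow> cmod u < \<rho>"
    and "\<And>v. cmod v < \<rho> \<Longrightarrow>
      (\<Sum>k\<le>length us. of_nat (length us choose k) * ((-1) ^ k * d k) * v ^ k) \<noteq> 0"
    and "\<rho> > 0"
  shows "(\<Sum>k\<le>length us. d k * coeff (\<Prod>u\<leftarrow>us. [:1, - u:]) k) \<noteq> 0"
  using assms
proof (induction us arbitrary: d)
  case Nil
  then show ?case using Nil(2)[of 0] by simp
next
  case (Cons u us)
  let ?m = "length us"
  let ?g = "\<Prod>u\<leftarrow>us. [:1, - u:]"
  let ?e = "\<lambda>k. (-1) ^ k * d k"
  define p where "p = (\<Sum>k\<le>Suc ?m. monom (of_nat (Suc ?m choose k) * ?e k) k)"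
  have pv: "poly p v = (\<Sum>k\<le>Suc ?m. of_nat (Suc ?m choose k) * ?e k * v ^ k)" for v
    by (simp add: p_def poly_sum poly_monom)
  have degp: "degree p \<le> Suc ?m"
    unfolding p_def by (intro degree_sum_le) (auto intro: order_trans[OF degree_monom_le])
  have "(\<Sum>k\<le>?m. (d k - u * d (Suc k)) * coeff ?g k) \<noteq> 0"
  proof (rule Cons.IH)
    fix v :: complex assume v: "cmod v < \<rho>"
    have "of_nat (Suc ?m) * poly p v + (u - v) * poly (pderiv p) v \<noteq> 0"
    proof (rule laguerre_polar_nonzero[OF degp])
      fix w :: complex assume "cmod w < \<rho>"
      then show "poly p w \<noteq> 0" unfolding pv using Cons.prems(2) by (simp only: list.size add_0_right add_Suc_right) simp
    qed (use Cons.prems v in auto)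
    \<comment> \<open>The sign in \<open>?e\<close> turns \<open>?e k + u * ?e (Suc k)\<close> into
      \<open>(-1) ^ k * (d k - u * d (Suc k))\<close>.\<close>
    then show "(\<Sum>k\<le>?m. of_nat (?m choose k) * ((-1) ^ k * (d k - u * d (Suc k))) * v ^ k) \<noteq> 0"
      unfolding p_def polar_binomial_sum mult_eq_0_iff
      by (simp only: de_Morgan_disj power_Suc) (simp add: right_diff_distrib mult_ac)
  qed (use Cons.prems in auto)
  moreover have "(\<Sum>k\<le>Suc ?m. d k * coeff ([:1, - u:] * ?g) k)
      = (\<Sum>k\<le>?m. (d k - u * d (Suc k)) * coeff ?g k)"
  proof -
    have g0: "coeff ?g (Suc ?m) = 0"
      by (rule coeff_eq_0) (use degree_prod_list_linear_le[of us] in auto)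
    have c: "coeff ([:1, - u:] * ?g) k = coeff ?g k - u * coeff (pCons 0 ?g) k" for k
      by (cases k) simp_all
    have "(\<Sum>k\<le>Suc ?m. d k * coeff ([:1, - u:] * ?g) k)
      = (\<Sum>k\<le>Suc ?m. d k * coeff ?g k - u * (d k * coeff (pCons 0 ?g) k))"
      unfolding c by (intro sum.cong refl) (simp only: right_diff_distrib mult.left_commute)
    also have "\<dots> = (\<Sum>k\<le>Suc ?m. d k * coeff ?g k) - u * (\<Sum>k\<le>Suc ?m. d k * coeff (pCons 0 ?g) k)"
      unfolding sum_distrib_left sum_subtractf ..
    also have "(\<Sum>k\<le>Suc ?m. d k * coeff ?g k) = (\<Sum>k\<le>?m. d k * coeff ?g k)"
      using g0 by simp
    also have "(\<Sum>k\<le>Suc ?m. d k * coeff (pCons 0 ?g) k) = (\<Sum>k\<le>?m. d (Suc k) * coeff ?g k)"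
      by (subst sum.atMost_Suc_shift) simp
    finally show ?thesis
      by (simp add: sum_distrib_left sum_subtractf algebra_simps)
  qed
  ultimately show ?case by simp
qed

section \<open>Enestrom-Kakeya and the roots of the inverse factor\<close>

lemma enestrom_kakeya_nonzero:
  fixes b :: "nat \<Rightarrow> real" and y :: complex
  assumes b0: "b 0 > 0" and dec: "\<And>k. b (Suc k) \<le> b k" and nonneg: "\<And>k. b k \<ge> 0"
    and y: "cmod y < 1"
  shows "(\<Sum>k\<le>m. of_real (b k) * y ^ k) \<noteq> 0"
proof
  assume 0: "(\<Sum>k\<le>m. of_real (b k) * y ^ k) = 0"
  let ?R = "(\<Sum>k<m. of_real (b k - b (Suc k)) * y ^ k) + of_real (b m) * y ^ m"
  \<comment> \<open>Multiplication by \<open>1 - y\<close> leaves \<open>b 0 = y * ?R\<close>, where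
    the coefficients of \<open>?R\<close> are nonnegative and sum to \<open>b 0\<close>. Hence
    \<open>?R\<close> has modulus at most \<open>b 0\<close>, which is impossible for
    \<open>|y| < 1\<close>.\<close>
  have "(1 - y) * (\<Sum>k\<le>m. of_real (b k) * y ^ k) = of_real (b 0) - y * ?R"
    by (induction m) (simp_all add: algebra_simps)
  with 0 have eq: "of_real (b 0) = y * ?R" by simp
  have t: "cmod (of_real c * y ^ k) \<le> c" if "c \<ge> 0" for c k
    using that y by (simp add: norm_mult norm_power mult_left_le power_le_one)
  have "cmod ?R \<le> (\<Sum>k<m. b k - b (Suc k)) + b m"
    by (intro order_trans[OF norm_triangle_ineq] add_mono order_trans[OF norm_sum] sum_mono t)
      (use dec nonneg in auto)
  also have "\<dots> = b 0" by (simp add: sum_lessThan_telescope')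
  finally have R: "cmod ?R \<le> b 0" .
  have "b 0 = cmod (of_real (b 0))" using b0 by simp
  also have "\<dots> = cmod y * cmod ?R" unfolding eq norm_mult ..
  also have "\<dots> \<le> cmod y * b 0" using R by (intro mult_left_mono) auto
  also have "\<dots> < b 0" using y b0 by simp
  finally show False by simp
qed

text \<open>Since \<open>(m choose k) * fact k = m! / (m - k)!\<close>, the sum is \<open>m!\<close>
  times the reversed truncated exponential series. In the variable \<open>m * y\<close> its
  coefficients have successive ratios \<open>(m - k) / m\<close>, at most 1, so Enestrom-Kakeya
  applies.\<close>

lemma binomial_fact_sum_nonzero:
  assumes m: "m \<ge> 1" and y: "real m * cmod y < 1"
  shows "(\<Sum>k\<le>m. of_nat (m choose k) * fact k * y ^ k) \<noteq> (0 :: complex)"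
proof -
  define b where "b k = real ((m choose k) * fact k) / real m ^ k" for k
  have step: "(m choose Suc k) * fact (Suc k) = (m - k) * ((m choose k) * fact k)" for k :: nat
  proof -
    have "Suc k * (m choose Suc k) = (m - k) * (m choose k)"
      using Suc_times_binomial_add binomial_absorb_comp binomial_absorption by metis
    moreover have "(m choose Suc k) * fact (Suc k) = (Suc k * (m choose Suc k)) * fact k"
      by (simp only: fact_Suc of_nat_id mult_ac)
    ultimately show ?thesis by (simp only: mult.assoc)
  qed
  have dec: "b (Suc k) \<le> b k" for k
  proof -
    have "b (Suc k) = b k * (real (m - k) / real m)"
      unfolding b_def step by (simp add: mult_ac)
    also have "\<dots> \<le> b k * 1"
      by (intro mult_left_mono) (use m in \<open>auto simp: b_def field_simps\<close>)
    finally show ?thesis by simp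
  qed
  have "(\<Sum>k\<le>m. of_real (b k) * (of_nat m * y) ^ k) \<noteq> 0"
    by (rule enestrom_kakeya_nonzero[where b = b, OF _ dec]) (use y in \<open>auto simp: b_def norm_mult\<close>)
  moreover have "of_real (b k) * (of_nat m * y) ^ k = of_nat (m choose k) * fact k * y ^ k" for k
    using m by (simp add: b_def power_mult_distrib)
  ultimately show ?thesis by simp
qed

text \<open>Let \<open>m = degree g\<close> and suppose no root of \<open>g\<close> is that near.
  After moving \<open>x\<close> to 0, every root \<open>w\<close> of \<open>h\<close> has
  \<open>|w| > m |\<gamma>|\<close>, so \<open>h\<close> is a multiple of a product of factors
  \<open>1 - u z\<close> with \<open>u = 1 / w\<close>. For nonzero \<open>\<gamma>\<close>, Walsh's
  theorem with \<open>d k = \<gamma> ^ k * fact k\<close> replaces all \<open>u\<close> by one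
  \<open>v\<close> with \<open>|v| < 1 / (m |\<gamma>|)\<close>, and the sum becomes that of
  \<open>binomial_fact_sum_nonzero\<close> at \<open>- (\<gamma> * v)\<close>.\<close>

lemma inv_id_minus_deriv_root_near:
  assumes deg: "degree g \<ge> 1" and root: "poly (inv_id_minus_deriv \<gamma> g) x = 0"
  obtains y where "poly g y = 0" "cmod (y - x) \<le> real (degree g) * cmod \<gamma>"
proof (rule ccontr)
  let ?m = "degree g"
  assume "\<not> thesis"
  with that have far: "real ?m * cmod \<gamma> < cmod (y - x)" if "poly g y = 0" for y
    using \<open>poly g y = 0\<close> not_le by blast
  \<comment> \<open>With \<open>h z = g (x + z)\<close> the assumption reads \<open>\<Sum> k! \<gamma>\<^sup>k * coeff h k = 0\<close>.\<close>
  define h where "h = pcompose g [:x, 1:]"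
  have degh: "degree h = ?m" by (simp add: h_def degree_pcompose)
  have h: "(pderiv ^^ k) h = pcompose ((pderiv ^^ k) g) [:x, 1:]" for k
    by (induction k) (simp_all add: h_def pderiv_pcompose pderiv_pCons)
  have "poly ((pderiv ^^ k) g) x = fact k * coeff h k" for k
  proof -
    have "poly ((pderiv ^^ k) g) x = poly ((pderiv ^^ k) h) 0" by (simp add: h poly_pcompose)
    also have "\<dots> = fact k * coeff h k"
      by (simp add: poly_0_coeff_0 coeff_higher_pderiv pochhammer_fact)
    finally show ?thesis .
  qed
  then have sum0: "(\<Sum>k\<le>?m. (\<gamma> ^ k * fact k) * coeff h k) = 0"
    using root by (simp add: inv_id_minus_deriv_def poly_sum mult.assoc)
  obtain ws where ws: "mset ws = proots h" using ex_mset by blast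
  have len: "length ws = ?m"
    using arg_cong[OF ws, of size] by (simp add: size_proots_complex degh)
  have h0: "h \<noteq> 0" using deg degh by auto
  have far': "real ?m * cmod \<gamma> < cmod w" if "w \<in> set ws" for w
  proof -
    have "w \<in># proots h" using that ws by (metis set_mset_mset)
    then have "poly g (x + w) = 0" using h0 by (simp add: h_def poly_pcompose)
    then show ?thesis using far[of "x + w"] by simp
  qed
  have w0: "w \<noteq> 0" if "w \<in> set ws" for w
    using far'[OF that] by (auto simp: mult_less_0_iff)
  define us where "us = map inverse ws"
  have lin: "[:- w, 1:] = smult (- w) [:1, - inverse w:]" if "w \<in> set ws" for w
    using w0[OF that] by simp
  have "(\<Prod>w\<leftarrow>vs. [:- w, 1:]) = smult (\<Prod>w\<leftarrow>vs. - w) (\<Prod>u\<leftarrow>map inverse vs. [:1, - u:])"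
    if "set vs \<subseteq> set ws" for vs
    using that
  proof (induction vs)
    case (Cons w vs)
    then have "w \<in> set ws"
      and IH: "(\<Prod>w\<leftarrow>vs. [:- w, 1:]) = smult (\<Prod>w\<leftarrow>vs. - w) (\<Prod>u\<leftarrow>map inverse vs. [:1, - u:])"
      by auto
    show ?case
      unfolding list.map prod_list.Cons lin[OF \<open>w \<in> set ws\<close>] IH
        mult_smult_left mult_smult_right smult_smult
      by (subst mult.commute[of "- w"]) (rule refl)
  qed simp
  from this[of ws] have prod: "(\<Prod>w\<leftarrow>ws. [:- w, 1:]) = smult (\<Prod>w\<leftarrow>ws. - w) (\<Prod>u\<leftarrow>us. [:1, - u:])"
    by (simp only: us_def)
  define c where "c = lead_coeff h * (\<Prod>w\<leftarrow>ws. - w)"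
  have "(\<Prod>x\<in>#proots h. [:- x, 1:]) = (\<Prod>w\<leftarrow>ws. [:- w, 1:])"
    by (simp add: ws[symmetric] prod_mset_prod_list flip: mset_map)
  then have c: "h = smult c (\<Prod>u\<leftarrow>us. [:1, - u:])"
    using complex_poly_decompose_multiset[of h] unfolding prod c_def smult_smult[symmetric] by metis
  have nz: "(\<Sum>k\<le>length us. (\<gamma> ^ k * fact k) * coeff (\<Prod>u\<leftarrow>us. [:1, - u:]) k) \<noteq> 0"
  \<comment> \<open>For \<open>\<gamma> = 0\<close> the radius \<open>1 / (m |\<gamma>|)\<close>
    would be \<open>1 / 0 = 0\<close>, leaving no disc for Walsh's theorem; here only the constant
    coefficient survives, and it equals 1.\<close>
  proof (cases "\<gamma> = 0")
    case True
    have nz: "(\<Sum>k\<le>length us. (\<gamma> ^ k * fact k) * coeff (\<Prod>u\<leftarrow>us. [:1, - u:]) k)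
       = coeff (\<Prod>u\<leftarrow>us. [:1, - u:]) 0"
      by (subst sum.mono_neutral_right[where S = "{0}"]) (use True in auto)
    also have "\<dots> = 1" by (induction us) (simp_all add: coeff_mult)
    finally show ?thesis by simp
  next
    case False
    then have p: "real ?m * cmod \<gamma> > 0" using deg by simp
    show ?thesis
    proof (rule walsh_coincidence_nonzero[where \<rho> = "1 / (real ?m * cmod \<gamma>)"])
      fix u assume "u \<in> set us"
      then obtain w where "w \<in> set ws" "u = inverse w" by (auto simp: us_def)
      then show "cmod u < 1 / (real ?m * cmod \<gamma>)"
        using far'[of w] p by (simp only: norm_inverse inverse_eq_divide norm_divide norm_one) (rule frac_less2, auto)
    next
      fix v :: complex assume v: "cmod v < 1 / (real ?m * cmod \<gamma>)"
      have "(\<Sum>k\<le>?m. of_nat (?m choose k) * fact k * (- (\<gamma> * v)) ^ k) \<noteq> 0"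
        by (rule binomial_fact_sum_nonzero[OF deg])
          (use v p in \<open>simp add: norm_mult pos_less_divide_eq mult_ac\<close>)
      moreover have "(- (\<gamma> * v)) ^ k = (-1) ^ k * \<gamma> ^ k * v ^ k" for k
        by (simp add: power_minus[of "\<gamma> * v"] power_mult_distrib)
      ultimately show "(\<Sum>k\<le>length us. of_nat (length us choose k) *
          ((-1) ^ k * (\<gamma> ^ k * fact k)) * v ^ k) \<noteq> 0"
        by (simp add: us_def len mult_ac)
    qed (use p in simp)
  qed
  have "length us = ?m" by (simp add: us_def len)
  moreover have "c \<noteq> 0" using c h0 by auto
  moreover have "coeff h k = c * coeff (\<Prod>u\<leftarrow>us. [:1, - u:]) k" for k
    unfolding c coeff_smult ..
  then have "c * (\<Sum>k\<le>?m. (\<gamma> ^ k * fact k) * coeff (\<Prod>u\<leftarrow>us. [:1, - u:]) k) = 0"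
    using sum0 by (simp only: sum_distrib_left mult.left_commute)
  ultimately show False using nz by simp
qed

section \<open>Matching along paths of polynomials\<close>

text \<open>Halmos-Vaughan induction. A proper nonempty \<open>J\<close> with equality
  (\<open>tight\<close>) is matched first and its values are removed; the condition for the rest
  follows by counting the neighbours of \<open>K \<union> J\<close>. Under strict inequality
  (\<open>slack\<close>) any single choice is safe, since removing one value costs at most
  one.\<close>

lemma hall_marriage:
  fixes N :: "'a \<Rightarrow> 'b set"
  assumes "finite I" and "\<And>i. i \<in> I \<Longrightarrow> finite (N i)"
    and "\<And>J. J \<subseteq> I \<Longrightarrow> card J \<le> card (\<Union>i\<in>J. N i)"
  shows "\<exists>f. inj_on f I \<and> (\<forall>i\<in>I. f i \<in> N i)"
  using assms
proof (induction "card I" arbitrary: I N rule: less_induct)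
  case less
  note fin = less.prems(1) and finN = less.prems(2) and hall = less.prems(3)
  have finU: "finite (\<Union>i\<in>J. N i)" if "J \<subseteq> I" for J
    using that finite_subset[OF that fin] finN by auto
  consider "I = {}"
    | (tight) J where "J \<subset> I" "J \<noteq> {}" "card (\<Union>i\<in>J. N i) = card J"
    | (slack) "I \<noteq> {}" "\<And>J. J \<subset> I \<Longrightarrow> J \<noteq> {} \<Longrightarrow> card J < card (\<Union>i\<in>J. N i)"
    using hall by (metis le_neq_implies_less psubset_imp_subset)
  then show ?case
  proof cases
    case 1
    then show ?thesis by auto
  next
    case tight
    let ?M = "\<Union>i\<in>J. N i"
    have JI: "J \<subseteq> I" and finJ: "finite J" using tight(1) fin finite_subset by auto
    have "card J < card I" using tight(1) fin psubset_card_mono by blast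
    then have "\<exists>f. inj_on f J \<and> (\<forall>i\<in>J. f i \<in> N i)"
    proof (rule less.hyps[OF _ finJ])
      show "finite (N i)" if "i \<in> J" for i using that JI finN by auto
      show "card K \<le> card (\<Union>i\<in>K. N i)" if "K \<subseteq> J" for K
        using that JI by (intro hall) auto
    qed
    then obtain f where f: "inj_on f J" "\<forall>i\<in>J. f i \<in> N i" by blast
    have less_card: "card (I - J) < card I"
      using tight(1,2) fin by (intro psubset_card_mono) auto
    have hall': "card K \<le> card (\<Union>i\<in>K. N i - ?M)" if K: "K \<subseteq> I - J" for K
    proof -
      have finK: "finite K" using K fin finite_subset by auto
      have "card K + card J = card (K \<union> J)"
        using K finK finJ by (intro card_Un_disjoint[symmetric]) auto
      also have "\<dots> \<le> card (\<Union>i\<in>K \<union> J. N i)" using K JI by (intro hall) auto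
      also have "(\<Union>i\<in>K \<union> J. N i) = (\<Union>i\<in>K. N i - ?M) \<union> ?M" by auto
      also have "card \<dots> \<le> card (\<Union>i\<in>K. N i - ?M) + card ?M" by (rule card_Un_le)
      finally show ?thesis using tight(3) by simp
    qed
    have "\<exists>g. inj_on g (I - J) \<and> (\<forall>i\<in>I - J. g i \<in> N i - ?M)"
      by (rule less.hyps[OF less_card _ _ hall']) (use fin finN in auto)
    then obtain g where g: "inj_on g (I - J)" "\<forall>i\<in>I - J. g i \<in> N i - ?M" by blast
    let ?h = "\<lambda>i. if i \<in> J then f i else g i"
    have "f ` J \<subseteq> ?M" "g ` (I - J) \<inter> ?M = {}" using f(2) g(2) by auto
    then have disj: "f ` J \<inter> g ` (I - J) = {}" by blast
    have "J \<union> (I - J) = I" using JI by auto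
    then have "inj_on ?h I" using inj_on_disjoint_Un[OF f(1) g(1) disj] by simp
    moreover have "\<forall>i\<in>I. ?h i \<in> N i"
    proof
      fix i assume "i \<in> I"
      then show "?h i \<in> N i" using f(2) g(2) by (cases "i \<in> J") auto
    qed
    ultimately show ?thesis by blast
  next
    case slack
    then obtain i where i: "i \<in> I" by auto
    have "card {i} \<le> card (\<Union>i\<in>{i}. N i)" using i by (intro hall) auto
    then obtain x where x: "x \<in> N i" by (cases "N i = {}") auto
    have less_card: "card (I - {i}) < card I" using fin i by (rule card_Diff1_less)
    have hall': "card K \<le> card (\<Union>j\<in>K. N j - {x})" if K: "K \<subseteq> I - {i}" for K
    proof (cases "K = {}")
      case False
      have less: "card K < card (\<Union>j\<in>K. N j)" using K i False by (intro slack(2)) auto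
      have finK: "finite (\<Union>j\<in>K. N j - {x})"
        by (rule finite_subset[OF _ finU[of K]]) (use K in auto)
      have "(\<Union>j\<in>K. N j) \<subseteq> insert x (\<Union>j\<in>K. N j - {x})" by auto
      then have "card (\<Union>j\<in>K. N j) \<le> card (insert x (\<Union>j\<in>K. N j - {x}))"
        using finK by (intro card_mono) auto
      also have "\<dots> \<le> Suc (card (\<Union>j\<in>K. N j - {x}))"
        using finK unfolding card.insert_remove[OF finK]
        by (intro Suc_le_mono[THEN iffD2] card_mono) auto
      finally show ?thesis using less by simp
    qed simp
    have "\<exists>g. inj_on g (I - {i}) \<and> (\<forall>j\<in>I - {i}. g j \<in> N j - {x})"
      by (rule less.hyps[OF less_card _ _ hall']) (use fin finN in auto)
    then obtain g where g: "inj_on g (I - {i})" "\<forall>j\<in>I - {i}. g j \<in> N j - {x}" by blast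
    have "inj_on (g(i := x)) I" using g by (auto simp: inj_on_def)
    moreover have "\<forall>j\<in>I. (g(i := x)) j \<in> N j" using g x by auto
    ultimately show ?thesis by blast
  qed
qed

text \<open>The intervals of radius \<open>S\<close> about the points \<open>c i\<close> have total
  length at most \<open>card I * (2 * S)\<close>, too little to cover the interval from
  \<open>a\<close> to \<open>b\<close>.\<close>

lemma ex_level_avoiding_intervals:
  fixes c :: "'a \<Rightarrow> real"
  assumes "finite I" and "S \<ge> 0" and "real (card I) * (2 * S) < b - a"
  obtains \<rho> where "a < \<rho>" "\<rho> < b" "\<And>i. i \<in> I \<Longrightarrow> S < \<bar>\<rho> - c i\<bar>"
proof (rule ccontr)
  assume "\<not> thesis"
  with that have "{a<..<b} \<subseteq> (\<Union>i\<in>I. {c i - S..c i + S})"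
    by (force simp: abs_le_iff not_less)
  moreover have "(\<Union>i\<in>I. {c i - S..c i + S}) \<in> lmeasurable"
    using assms(1) by (intro fmeasurable.finite_UN) auto
  ultimately have "measure lebesgue {a<..<b} \<le> measure lebesgue (\<Union>i\<in>I. {c i - S..c i + S})"
    by (intro measure_mono_fmeasurable) auto
  also have "\<dots> \<le> (\<Sum>i\<in>I. measure lebesgue {c i - S..c i + S})"
    using assms(1) by (intro measure_UNION_le) auto
  also have "\<dots> = real (card I) * (2 * S)" using assms(2) by simp
  finally have "max 0 (b - a) \<le> real (card I) * (2 * S)" by (auto simp: max_def split: if_splits)
  then show False using assms(3) by simp
qed

text \<open>Bolzano-Weierstrass one coordinate at a time; thinning the subsequence further keeps the
  earlier limits.\<close>

lemma ex_common_convergent_subseq: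
  fixes z :: "nat \<Rightarrow> nat \<Rightarrow> complex"
  assumes "\<And>j k. k < m \<Longrightarrow> cmod (z j k) \<le> K"
  shows "\<exists>r l. strict_mono r \<and> (\<forall>k<m. (\<lambda>j. z (r j) k) \<longlonglongrightarrow> l k)"
  using assms
proof (induction m)
  case 0
  show ?case by (rule exI[of _ id]) (auto simp: strict_mono_def)
next
  case (Suc m)
  then obtain r l where r: "strict_mono r" and l: "\<And>k. k < m \<Longrightarrow> (\<lambda>j. z (r j) k) \<longlonglongrightarrow> l k"
    by (metis less_SucI)
  have "bounded (range (\<lambda>j. z (r j) m))"
    using Suc.prems by (auto simp: bounded_iff)
  then obtain x s where s: "strict_mono s" and x: "((\<lambda>j. z (r j) m) \<circ> s) \<longlonglongrightarrow> x"
    using bounded_imp_convergent_subsequence by blast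
  have "strict_mono (r \<circ> s)" using r s by (rule strict_mono_o)
  moreover have "(\<lambda>j. z ((r \<circ> s) j) k) \<longlonglongrightarrow> (l(m := x)) k" if "k < Suc m" for k
  proof (cases "k = m")
    case True
    then show ?thesis using x by (simp add: o_def)
  next
    case False
    then show ?thesis
      using LIMSEQ_subseq_LIMSEQ[OF l s, of k] that by (simp add: o_def)
  qed
  ultimately show ?case by blast
qed

section \<open>Counting roots along a path\<close>

lemma poly_eq_prod_roots:
  fixes p :: "complex poly"
  assumes "mset xs = proots p"
  shows "poly p w = lead_coeff p * (\<Prod>k<length xs. w - xs ! k)"
proof -
  have "poly p w = lead_coeff p * poly (\<Prod>x\<in>#proots p. [:- x, 1:]) w"
    using arg_cong[OF complex_poly_decompose_multiset[of p], of "\<lambda>q. poly q w"] by simp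
  also have "(\<Prod>x\<in>#proots p. [:- x, 1:]) = (\<Prod>x\<leftarrow>xs. [:- x, 1:])"
    by (simp add: assms[symmetric] prod_mset_prod_list flip: mset_map)
  also have "poly (\<Prod>x\<leftarrow>xs. [:- x, 1:]) w = (\<Prod>x\<leftarrow>xs. w - x)"
    by (induction xs) (simp_all add: algebra_simps)
  also have "\<dots> = (\<Prod>k<length xs. w - xs ! k)"
    by (subst prod.list_conv_set_nth) (auto simp: atLeast0LessThan)
  finally show ?thesis .
qed

text \<open>Serves to recognise limits of root lists as the roots, with multiplicity, of the limit
  polynomial.\<close>

lemma proots_eqI:
  fixes p :: "complex poly"
  assumes "\<And>w. poly p w = c * (\<Prod>k<m. w - l k)" and "c \<noteq> 0"
  shows "proots p = mset (map l [0..<m])"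
proof -
  have "p = smult c (\<Prod>k<m. [:- l k, 1:])"
    by (intro poly_ext) (simp add: assms(1) poly_prod)
  then have "proots p = proots (\<Prod>k<m. [:- l k, 1:])" using assms(2) by simp
  also have "\<dots> = (\<Sum>k<m. {#l k#})" by (subst proots_prod) auto
  also have "\<dots> = mset (map l [0..<m])" by (induction m) simp_all
  finally show ?thesis .
qed

lemma size_filter_mset_conv_card:
  "size (filter_mset (\<lambda>z. z \<in> U) (mset xs)) = card {k. k < length xs \<and> xs ! k \<in> U}"
  by (simp add: length_filter_conv_card flip: mset_filter)

text \<open>A fixed nonzero leading coefficient keeps the number of roots at \<open>m\<close> and
  lets the factorisation pass to limits. Displacements are measured from \<open>P 0\<close> only, so
  control from the other endpoint requires a separate path.\<close>

definition root_path :: "nat \<Rightarrow> real \<Rightarrow> (real \<Rightarrow> complex poly) \<Rightarrow> bool" where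
  "root_path m S P \<longleftrightarrow>
     (\<exists>c. c \<noteq> 0 \<and> (\<forall>t\<in>{0..1}. degree (P t) = m \<and> coeff (P t) m = c)) \<and>
     (\<forall>i. continuous_on {0..1} (\<lambda>t. coeff (P t) i)) \<and>
     (\<forall>t\<in>{0..1}. \<forall>z. poly (P t) z = 0 \<longrightarrow> (\<exists>x. poly (P 0) x = 0 \<and> cmod (x - z) \<le> S))"

text \<open>The times with a given count form a closed set: along a convergent sequence of times the
  roots subconverge to those of the limit polynomial, and the disjoint open sets \<open>U\<close>
  and \<open>V\<close> decide on which side each one eventually lies. Only finitely many counts
  occur, so connectedness of the unit interval makes the count constant.\<close>

lemma root_path_count_constant:
  assumes path: "root_path m S P"
    and U: "open U" "open V" "U \<inter> V = {}"
    and UV: "\<And>t z. t \<in> {0..1} \<Longrightarrow> poly (P t) z = 0 \<Longrightarrow> z \<in> U \<union> V"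
  shows "size (filter_mset (\<lambda>z. z \<in> U) (proots (P 0))) = size (filter_mset (\<lambda>z. z \<in> U) (proots (P 1)))"
proof -
  obtain c where c: "c \<noteq> 0" and deg: "\<And>t. t \<in> {0..1} \<Longrightarrow> degree (P t) = m"
    and lc: "\<And>t. t \<in> {0..1} \<Longrightarrow> coeff (P t) m = c"
    using path unfolding root_path_def by blast
  have cont: "\<And>i. continuous_on {0..1} (\<lambda>t. coeff (P t) i)"
    and near: "\<And>t z. t \<in> {0..1} \<Longrightarrow> poly (P t) z = 0 \<Longrightarrow> \<exists>x. poly (P 0) x = 0 \<and> cmod (x - z) \<le> S"
    using path unfolding root_path_def by blast+
  have nz: "P t \<noteq> 0" if "t \<in> {0..1}" for t using lc[OF that] c by auto
  have "finite {x. poly (P 0) x = 0}" using nz[of 0] by (intro poly_roots_finite) auto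
  then obtain K0 where K0: "\<And>x. poly (P 0) x = 0 \<Longrightarrow> cmod x \<le> K0"
    using finite_imp_bounded[of "{x. poly (P 0) x = 0}"] by (auto simp: bounded_iff)
  have bnd: "cmod z \<le> K0 + S" if t: "t \<in> {0..1}" and z: "poly (P t) z = 0" for t z
  proof -
    obtain x where "poly (P 0) x = 0" "cmod (x - z) \<le> S" using near[OF t z] by blast
    then show ?thesis using K0[of x] norm_triangle_sub[of z x] by (simp add: norm_minus_commute)
  qed
  \<comment> \<open>The enumeration is chosen separately at each \<open>t\<close>, with no
    continuity in \<open>t\<close>; hence the passage to subsequences below.\<close>
  define zs where "zs t = (SOME xs. mset xs = proots (P t))" for t
  have zs: "mset (zs t) = proots (P t)" for t
    unfolding zs_def by (rule someI_ex) (rule ex_mset)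
  have len: "length (zs t) = m" if "t \<in> {0..1}" for t
    using arg_cong[OF zs[of t], of size] by (simp add: size_proots_complex deg[OF that])
  have root: "poly (P t) (zs t ! k) = 0" if "t \<in> {0..1}" "k < m" for t k
  proof -
    have "zs t ! k \<in># proots (P t)" using that len zs by (metis nth_mem set_mset_mset)
    then show ?thesis using nz[OF that(1)] by simp
  qed
  define N where "N t = size (filter_mset (\<lambda>z. z \<in> U) (proots (P t)))" for t
  have N: "N t = card {k. k < m \<and> zs t ! k \<in> U}" if "t \<in> {0..1}" for t
    unfolding N_def zs[symmetric] size_filter_mset_conv_card len[OF that] ..
  have closed: "closed {t \<in> {0..1}. N t = q}" for q
    unfolding closed_sequential_limits
  proof (intro allI impI, elim conjE)
    fix s :: "nat \<Rightarrow> real" and t0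
    assume s: "\<forall>j. s j \<in> {t \<in> {0..1}. N t = q}" and lim: "s \<longlonglongrightarrow> t0"
    have s01: "s j \<in> {0..1}" and sN: "N (s j) = q" for j using s by auto
    have t0: "t0 \<in> {0..1}"
      using closed_sequentially[of "{0..1::real}" s t0] s01 lim by auto
    obtain r l where r: "strict_mono r"
      and l: "\<And>k. k < m \<Longrightarrow> (\<lambda>j. zs (s (r j)) ! k) \<longlonglongrightarrow> l k"
      using ex_common_convergent_subseq[of m "\<lambda>j k. zs (s j) ! k" "K0 + S"] bnd root s01 by blast
    have sr: "(\<lambda>j. s (r j)) \<longlonglongrightarrow> t0"
      using LIMSEQ_subseq_LIMSEQ[OF lim r] by (simp add: o_def)
    have P0: "poly (P t0) w = c * (\<Prod>k<m. w - l k)" for w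
    proof (rule LIMSEQ_unique)
      have "(\<lambda>j. coeff (P (s (r j))) i) \<longlonglongrightarrow> coeff (P t0) i" for i
        using continuous_on_tendsto_compose[OF cont[of i] sr t0] s01 by simp
      then have "(\<lambda>j. \<Sum>i\<le>m. coeff (P (s (r j))) i * w ^ i) \<longlonglongrightarrow> (\<Sum>i\<le>m. coeff (P t0) i * w ^ i)"
        by (intro tendsto_intros)
      then show "(\<lambda>j. poly (P (s (r j))) w) \<longlonglongrightarrow> poly (P t0) w"
        using deg s01 t0 by (simp add: poly_altdef)
      have "(\<lambda>j. c * (\<Prod>k<m. w - zs (s (r j)) ! k)) \<longlonglongrightarrow> c * (\<Prod>k<m. w - l k)"
        using l by (intro tendsto_intros) auto
      moreover have "poly (P (s (r j))) w = c * (\<Prod>k<m. w - zs (s (r j)) ! k)" for j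
        using poly_eq_prod_roots[OF zs, of "s (r j)" w] len[OF s01] deg[OF s01] lc[OF s01] by simp
      ultimately show "(\<lambda>j. poly (P (s (r j))) w) \<longlonglongrightarrow> c * (\<Prod>k<m. w - l k)" by simp
    qed
    have N0: "N t0 = card {k. k < m \<and> l k \<in> U}"
      unfolding N_def proots_eqI[OF P0 c] size_filter_mset_conv_card
      by (intro arg_cong[where f = card]) auto
    have "poly (P t0) (l k) = 0" if "k < m" for k
      unfolding P0 using that by (auto intro!: prod_zero)
    then have lUV: "l k \<in> U \<union> V" if "k < m" for k using UV[OF t0] that by blast
    have "\<forall>\<^sub>F j in sequentially. (zs (s (r j)) ! k \<in> U) = (l k \<in> U)" if k: "k < m" for k
    proof (cases "l k \<in> U")
      case True
      from topological_tendstoD[OF l[OF k] U(1) this]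
      show ?thesis by eventually_elim (use True in auto)
    next
      case False
      then have "l k \<in> V" using lUV[OF k] by auto
      from topological_tendstoD[OF l[OF k] U(2) this]
      show ?thesis by eventually_elim (use False U(3) in auto)
    qed
    then have "\<forall>\<^sub>F j in sequentially. \<forall>k\<in>{..<m}. (zs (s (r j)) ! k \<in> U) = (l k \<in> U)"
      by (intro eventually_ball_finite) auto
    then obtain j where "\<forall>k\<in>{..<m}. (zs (s (r j)) ! k \<in> U) = (l k \<in> U)"
      using eventually_happens'[OF trivial_limit_sequentially] by blast
    then have "{k. k < m \<and> zs (s (r j)) ! k \<in> U} = {k. k < m \<and> l k \<in> U}" by auto
    then have "N t0 = q" using N0 N[OF s01[of "r j"]] sN by metis
    then show "t0 \<in> {t \<in> {0..1}. N t = q}" using t0 by simp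
  qed
  have Nm: "N t \<le> m" if "t \<in> {0..1}" for t
    unfolding N[OF that] using card_mono[of "{..<m}" "{k. k < m \<and> zs t ! k \<in> U}"] by auto
  let ?A = "{t \<in> {0..1}. N t = N 0}" and ?B = "\<Union>q\<in>{..m} - {N 0}. {t \<in> {0..1}. N t = q}"
  have "closed ?B" using closed by (intro closed_UN) (simp_all del: atLeastAtMost_iff)
  moreover have "{0..1} \<subseteq> ?A \<union> ?B" using Nm by auto
  moreover have "?A \<inter> ?B \<inter> {0..1} = {}" by auto
  moreover have "?A \<inter> {0..1} \<noteq> {}" by auto
  ultimately have "?B \<inter> {0..1} = {}"
    using connected_closedD[of "{0..1::real}" ?A ?B] closed[of "N 0"] by simp
  moreover have "1 \<in> ?B \<inter> {0..1}" if "N 1 \<noteq> N 0" using Nm[of 1] that by auto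
  ultimately have "N 1 = N 0" by blast
  then show ?thesis by (simp add: N_def)
qed

text \<open>Measure the distance \<open>\<phi>\<close> to the roots in \<open>A\<close>. Every root on the path either has \<open>\<phi> \<le> S\<close> or
  \<open>\<phi>\<close> within \<open>S\<close> of its value at one of the at most \<open>(m - 1) / 2\<close> other initial roots, so some
  level below the distance from \<open>A\<close> to \<open>B\<close> is never crossed.\<close>
lemma root_path_no_deficient_pair:
  assumes path: "root_path m S P" and S: "S \<ge> 0"
    and xs: "mset xs = proots (P 0)" and ys: "mset ys = proots (P 1)"
    and A: "A \<subseteq> {..<m}" and B: "B \<subseteq> {..<m}"
    and card: "card A + card B > m" "2 * card A > m"
    and far: "\<And>i j. i \<in> A \<Longrightarrow> j \<in> B \<Longrightarrow> cmod (xs ! i - ys ! j) > real m * S"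
  shows False
proof -
  obtain c where c: "c \<noteq> 0" "\<And>t. t \<in> {0..1} \<Longrightarrow> degree (P t) = m \<and> coeff (P t) m = c"
    using path unfolding root_path_def by blast
  have deg: "degree (P 0) = m" "degree (P 1) = m" using c(2)[of 0] c(2)[of 1] by auto
  have nz: "P 0 \<noteq> 0" using c(1) c(2)[of 0] by auto
  have near: "\<And>t z. t \<in> {0..1} \<Longrightarrow> poly (P t) z = 0 \<Longrightarrow> \<exists>x. poly (P 0) x = 0 \<and> cmod (x - z) \<le> S"
    using path unfolding root_path_def by blast
  have lx: "length xs = m" using arg_cong[OF xs, of size] deg by (simp add: size_proots_complex)
  have ly: "length ys = m" using arg_cong[OF ys, of size] deg by (simp add: size_proots_complex)
  have fin: "finite A" "finite B" using A B finite_subset by blast+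
  have cA: "card A \<le> m" "card B \<le> m"
    using card_mono[OF _ A] card_mono[OF _ B] by auto
  then have ne: "A \<noteq> {}" "B \<noteq> {}" using card by auto
  define X where "X = (\<lambda>i. xs ! i) ` A"
  have X: "finite X" "X \<noteq> {}" using fin ne by (auto simp: X_def)
  define \<phi> where "\<phi> z = infdist z X" for z
  define \<delta> where "\<delta> = Min ((\<lambda>(i, j). cmod (xs ! i - ys ! j)) ` (A \<times> B))"
  have \<delta>: "\<delta> > real m * S"
    unfolding \<delta>_def using fin ne far by (subst Min_gr_iff) auto
  have \<delta>le: "\<delta> \<le> cmod (xs ! i - ys ! j)" if "i \<in> A" "j \<in> B" for i j
    unfolding \<delta>_def using fin that by (intro Min_le) auto
  have \<phi>B: "\<phi> (ys ! j) \<ge> \<delta>" if "j \<in> B" for j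
    unfolding \<phi>_def infdist_notempty[OF X(2)]
    by (intro cINF_greatest X(2)) (auto simp: X_def dist_norm norm_minus_commute \<delta>le that)
  have cardI: "card ({..<m} - A) = m - card A" using A fin by (simp add: card_Diff_subset)
  \<comment> \<open>Since \<open>2 * card A > m\<close>, at most \<open>(m - 1) / 2\<close> indices
    lie outside \<open>A\<close>, and their intervals of length \<open>2 * S\<close> take up at most
    \<open>(m - 1) * S\<close>, less than \<open>\<delta> - S\<close>. Levels up to \<open>S\<close>
    are left to the roots near \<open>X\<close>, where \<open>\<phi>\<close> vanishes.\<close>
  have "real (card ({..<m} - A)) * 2 \<le> real m - 1"
    unfolding cardI using card(2) cA by linarith
  then have "real (card ({..<m} - A)) * 2 * S \<le> (real m - 1) * S"
    using S by (intro mult_right_mono) auto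
  then have "real (card ({..<m} - A)) * (2 * S) < \<delta> - S"
    using \<delta> by (simp add: algebra_simps)
  then obtain \<rho> where \<rho>: "S < \<rho>" "\<rho> < \<delta>" and gap: "\<And>i. i \<in> {..<m} - A \<Longrightarrow> S < \<bar>\<rho> - \<phi> (xs ! i)\<bar>"
    using ex_level_avoiding_intervals[of "{..<m} - A" S \<delta> S "\<lambda>i. \<phi> (xs ! i)"] S by auto
  have level: "\<phi> z \<noteq> \<rho>" if t: "t \<in> {0..1}" and z: "poly (P t) z = 0" for t z
  proof
    assume eq: "\<phi> z = \<rho>"
    obtain x where x: "poly (P 0) x = 0" "cmod (x - z) \<le> S" using near[OF t z] by blast
    then have "x \<in># mset xs" using nz by (simp add: xs)
    then obtain i where i: "i < m" "x = xs ! i" by (auto simp: in_set_conv_nth lx)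
    have d: "\<bar>\<phi> z - \<phi> x\<bar> \<le> S"
      using infdist_triangle_abs[of z X x] x(2) by (simp add: \<phi>_def dist_norm norm_minus_commute)
    show False
    proof (cases "i \<in> A")
      case True
      then have "\<phi> x = 0" unfolding \<phi>_def using i X by (intro infdist_zero) (auto simp: X_def)
      then show False using d eq \<rho> by simp
    next
      case False
      then show False using gap[of i] i d eq by simp
    qed
  qed
  \<comment> \<open>\<open>?U\<close> contains the \<open>A\<close>-roots at time 0 and none of the
    \<open>B\<close>-roots at time 1, so a constant count yields
    \<open>card A \<le> m - card B\<close>.\<close>
  let ?U = "{z. \<phi> z < \<rho>}" and ?V = "{z. \<phi> z > \<rho>}"
  have "continuous_on UNIV \<phi>" unfolding \<phi>_def by (intro continuous_intros)
  then have "open ?U" "open ?V"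
    using open_Collect_less[of \<phi> "\<lambda>_. \<rho>"] open_Collect_less[of "\<lambda>_. \<rho>" \<phi>] by auto
  then have eq: "size (filter_mset (\<lambda>z. z \<in> ?U) (proots (P 0))) = size (filter_mset (\<lambda>z. z \<in> ?U) (proots (P 1)))"
    using level by (intro root_path_count_constant[OF path, where V = ?V]) fastforce+
  have "\<phi> (xs ! i) < \<rho>" if "i \<in> A" for i
  proof -
    have "\<phi> (xs ! i) = 0" unfolding \<phi>_def using that by (intro infdist_zero) (auto simp: X_def)
    then show ?thesis using \<rho> S by simp
  qed
  then have "card A \<le> card {k. k < length xs \<and> xs ! k \<in> ?U}"
    using A lx by (intro card_mono) auto
  also have "\<dots> = card {k. k < length ys \<and> ys ! k \<in> ?U}"
    using eq unfolding xs[symmetric] ys[symmetric] size_filter_mset_conv_card .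
  also have "\<dots> \<le> card ({..<m} - B)"
    using \<phi>B \<rho>(2) ly by (intro card_mono) force+
  also have "\<dots> = m - card B" using B fin by (simp add: card_Diff_subset)
  finally show False using card(1) cA by linarith
qed

lemma root_paths_matching:
  assumes P: "root_path m S P" and R: "root_path m S R" and S: "S \<ge> 0"
    and PR: "proots (P 0) = mset xs" "proots (P 1) = mset ys"
      "proots (R 0) = mset ys" "proots (R 1) = mset xs"
  obtains \<sigma> where "bij_betw \<sigma> {..<m} {..<m}"
    "\<And>i. i < m \<Longrightarrow> cmod (xs ! i - ys ! \<sigma> i) \<le> real m * S"
proof -
  define N where "N i = {j \<in> {..<m}. cmod (xs ! i - ys ! j) \<le> real m * S}" for i
  have "card J \<le> card (\<Union>i\<in>J. N i)" if J: "J \<subseteq> {..<m}" for J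
  proof (rule ccontr)
    assume "\<not> card J \<le> card (\<Union>i\<in>J. N i)"
    then have less: "card (\<Union>i\<in>J. N i) < card J" by simp
    \<comment> \<open>A violation \<open>J\<close> of Hall's condition gives \<open>J\<close> and
      \<open>B\<close> more than \<open>m\<close> elements together, so one of them has more than
      \<open>m / 2\<close>. That one is the starting set, with path \<open>P\<close> for
      \<open>J\<close> and path \<open>R\<close> for \<open>B\<close>.\<close>
    define B where "B = {..<m} - (\<Union>i\<in>J. N i)"
    have B: "B \<subseteq> {..<m}" by (auto simp: B_def)
    have "(\<Union>i\<in>J. N i) \<subseteq> {..<m}" by (auto simp: N_def)
    then have "card B = m - card (\<Union>i\<in>J. N i)" "card (\<Union>i\<in>J. N i) \<le> m"
      using card_mono[of "{..<m}" "\<Union>i\<in>J. N i"]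
      by (auto simp: B_def card_Diff_subset finite_subset)
    then have sum: "card J + card B > m" using less by linarith
    have far: "cmod (xs ! i - ys ! j) > real m * S" if "i \<in> J" "j \<in> B" for i j
      using that B by (force simp: B_def N_def)
    show False
    proof (cases "2 * card J > m")
      case True
      then show False
        using root_path_no_deficient_pair[OF P S PR(1,2)[symmetric] J B sum] far by blast
    next
      case False
      then have "2 * card B > m" using sum by linarith
      then show False
        using root_path_no_deficient_pair[OF R S PR(3,4)[symmetric] B J] sum far
        by (metis add.commute norm_minus_commute)
    qed
  qed
  then obtain \<sigma> where \<sigma>: "inj_on \<sigma> {..<m}" "\<forall>i\<in>{..<m}. \<sigma> i \<in> N i"
    using hall_marriage[of "{..<m}" N] by (auto simp: N_def)
  then have "\<sigma> ` {..<m} \<subseteq> {..<m}" by (auto simp: N_def)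
  then have "\<sigma> ` {..<m} = {..<m}" using \<sigma>(1) by (simp add: endo_inj_surj)
  then have "bij_betw \<sigma> {..<m} {..<m}" using \<sigma>(1) by (simp add: bij_betw_def)
  with \<sigma>(2) show ?thesis using that by (auto simp: N_def)
qed

section \<open>Products of factors\<close>

lemma lead_coeff_id_minus_deriv:
  "coeff (id_minus_deriv \<gamma> f) (degree f) = lead_coeff f"
  by (simp add: coeff_id_minus_deriv coeff_eq_0)

lemma inv_id_minus_deriv_0 [simp]: "inv_id_minus_deriv 0 f = f"
  using inv_id_minus_deriv_id_minus_deriv[of 0 f] by (simp add: id_minus_deriv_def)

text \<open>Collects what a factor and its inverse have in common, so that products of either kind
  are treated once. Continuity is asked for along paths of constant degree because the length of the
  inverse series depends on the degree.\<close>

locale near_identity =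
  fixes h :: "complex \<Rightarrow> complex poly \<Rightarrow> complex poly"
  assumes degree_h: "\<And>\<gamma> f. degree (h \<gamma> f) = degree f"
    and lead_coeff_h: "\<And>\<gamma> f. coeff (h \<gamma> f) (degree f) = lead_coeff f"
    and h_0: "\<And>f. h 0 f = f"
    and root_h: "\<And>\<gamma> f x. degree f \<ge> 1 \<Longrightarrow> poly (h \<gamma> f) x = 0 \<Longrightarrow>
      \<exists>y. poly f y = 0 \<and> cmod (y - x) \<le> real (degree f) * cmod \<gamma>"
    and continuous_h: "\<And>m \<gamma> (p :: real \<Rightarrow> complex poly) i. (\<And>t. degree (p t) = m) \<Longrightarrow>
      (\<And>i. continuous_on UNIV (\<lambda>t. coeff (p t) i)) \<Longrightarrow>
      continuous_on UNIV (\<lambda>t. coeff (h (of_real t * \<gamma>) (p t)) i)"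
begin

lemma degree_fold: "degree (foldr h \<gamma>s f) = degree f"
  by (induction \<gamma>s) (simp_all add: degree_h)

lemma lead_coeff_fold: "coeff (foldr h \<gamma>s f) (degree f) = lead_coeff f"
proof (induction \<gamma>s)
  case (Cons \<gamma> \<gamma>s)
  then show ?case using lead_coeff_h[of \<gamma> "foldr h \<gamma>s f"] by (simp add: degree_fold)
qed simp

text \<open>Every factor preserves the degree, so the displacements add up with the same constant
  \<open>degree f\<close>.\<close>

lemma root_fold:
  assumes "degree f \<ge> 1" "poly (foldr h \<gamma>s f) x = 0"
  shows "\<exists>y. poly f y = 0 \<and> cmod (y - x) \<le> real (degree f) * (\<Sum>\<gamma>\<leftarrow>\<gamma>s. cmod \<gamma>)"
  using assms(2)
proof (induction \<gamma>s arbitrary: x)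
  case Nil
  then show ?case by (intro exI[of _ x]) simp
next
  case (Cons \<gamma> \<gamma>s)
  then obtain z where z: "poly (foldr h \<gamma>s f) z = 0" "cmod (z - x) \<le> real (degree f) * cmod \<gamma>"
    using root_h[of "foldr h \<gamma>s f" \<gamma> x] assms(1) by (auto simp: degree_fold)
  obtain y where y: "poly f y = 0" "cmod (y - z) \<le> real (degree f) * (\<Sum>\<gamma>\<leftarrow>\<gamma>s. cmod \<gamma>)"
    using Cons.IH[OF z(1)] by blast
  have "cmod (y - x) \<le> cmod (y - z) + cmod (z - x)"
    using norm_triangle_ineq[of "y - z" "z - x"] by simp
  also have "\<dots> \<le> real (degree f) * (\<Sum>\<gamma>\<leftarrow>\<gamma> # \<gamma>s. cmod \<gamma>)"
    using y z by (simp add: algebra_simps)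
  finally show ?case using y by blast
qed

lemma continuous_fold:
  "continuous_on UNIV (\<lambda>t. coeff (foldr h (map ((*) (complex_of_real t)) \<gamma>s) f) i)"
proof (induction \<gamma>s arbitrary: i)
  case (Cons \<gamma> \<gamma>s)
  then show ?case by (auto intro!: continuous_h simp: degree_fold)
qed simp

text \<open>Scaling all parameters by \<open>t\<close> joins \<open>f\<close> to the full product.
  As \<open>t \<le> 1\<close>, the bound of \<open>root_fold\<close> for the full product is valid
  on the whole path.\<close>

lemma root_path_fold:
  assumes "degree f \<ge> 1"
  shows "root_path (degree f) (real (degree f) * (\<Sum>\<gamma>\<leftarrow>\<gamma>s. cmod \<gamma>))
    (\<lambda>t. foldr h (map ((*) (complex_of_real t)) \<gamma>s) f)"
  unfolding root_path_def
proof (intro conjI allI ballI impI)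
  have "lead_coeff f \<noteq> 0" using assms by auto
  then show "\<exists>c. c \<noteq> 0 \<and> (\<forall>t\<in>{0..1}.
      degree (foldr h (map ((*) (complex_of_real t)) \<gamma>s) f) = degree f \<and>
      coeff (foldr h (map ((*) (complex_of_real t)) \<gamma>s) f) (degree f) = c)"
    by (intro exI[of _ "lead_coeff f"]) (simp add: degree_fold lead_coeff_fold)
  show "continuous_on {0..1} (\<lambda>t. coeff (foldr h (map ((*) (complex_of_real t)) \<gamma>s) f) i)" for i
    by (rule continuous_on_subset[OF continuous_fold]) simp
  fix t :: real and z
  assume t: "t \<in> {0..1}" and "poly (foldr h (map ((*) (complex_of_real t)) \<gamma>s) f) z = 0"
  from root_fold[OF assms this(2)]
  obtain y where y: "poly f y = 0"
    "cmod (y - z) \<le> real (degree f) * (\<Sum>\<gamma>\<leftarrow>map ((*) (complex_of_real t)) \<gamma>s. cmod \<gamma>)"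
    by blast
  have "(\<Sum>\<gamma>\<leftarrow>map ((*) (complex_of_real t)) \<gamma>s. cmod \<gamma>) \<le> (\<Sum>\<gamma>\<leftarrow>\<gamma>s. cmod \<gamma>)"
  proof -
    have "cmod (of_real t * \<gamma>) \<le> cmod \<gamma>" for \<gamma>
      using t by (simp add: norm_mult mult_left_le_one_le)
    then show ?thesis by (simp only: map_map o_def sum_list_mono)
  qed
  then have "cmod (y - z) \<le> real (degree f) * (\<Sum>\<gamma>\<leftarrow>\<gamma>s. cmod \<gamma>)"
    using y(2) by (elim order_trans[OF _ mult_left_mono]) simp_all
  moreover have "foldr h (map ((*) (complex_of_real 0)) \<gamma>s) f = f"
    by (induction \<gamma>s) (simp_all add: h_0)
  ultimately show "\<exists>x. poly (foldr h (map ((*) (complex_of_real 0)) \<gamma>s) f) x = 0 \<and>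
      cmod (x - z) \<le> real (degree f) * (\<Sum>\<gamma>\<leftarrow>\<gamma>s. cmod \<gamma>)"
    using y(1) by auto
qed

end

interpretation fwd: near_identity id_minus_deriv
proof
  show "\<exists>y. poly f y = 0 \<and> cmod (y - x) \<le> real (degree f) * cmod \<gamma>"
    if "degree f \<ge> 1" "poly (id_minus_deriv \<gamma> f) x = 0" for \<gamma> f x
    using id_minus_deriv_root_near[OF that] by blast
  show "continuous_on UNIV (\<lambda>t. coeff (id_minus_deriv (of_real t * \<gamma>) (p t)) i)"
    if "\<And>i. continuous_on UNIV (\<lambda>t. coeff (p t) i)" for \<gamma> i and p :: "real \<Rightarrow> complex poly"
    unfolding coeff_id_minus_deriv by (intro continuous_intros that)
qed (simp_all add: lead_coeff_id_minus_deriv, simp add: id_minus_deriv_def)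

interpretation bwd: near_identity inv_id_minus_deriv
proof
  show "\<exists>y. poly f y = 0 \<and> cmod (y - x) \<le> real (degree f) * cmod \<gamma>"
    if "degree f \<ge> 1" "poly (inv_id_minus_deriv \<gamma> f) x = 0" for \<gamma> f x
    using inv_id_minus_deriv_root_near[OF that] by blast
  show "continuous_on UNIV (\<lambda>t. coeff (inv_id_minus_deriv (of_real t * \<gamma>) (p t)) i)"
    if "\<And>t. degree (p t) = m" and "\<And>i. continuous_on UNIV (\<lambda>t. coeff (p t) i)"
    for m \<gamma> i and p :: "real \<Rightarrow> complex poly"
  proof -
    have "degree (p t) \<le> m" for t using that(1) by simp
    from coeff_inv_id_minus_deriv[OF this] show ?thesis
      by (simp only:) (intro continuous_intros that(2))
  qed
qed (simp_all add: lead_coeff_inv_id_minus_deriv)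

section \<open>Factorisation of \<open>Top\<close>\<close>

lemma foldr_inv_id_minus_deriv_fold:
  "foldr inv_id_minus_deriv \<gamma>s (foldr id_minus_deriv (rev \<gamma>s) f) = f"
  \<comment> \<open>The factor applied last is undone first, whence the reversal.\<close>
  by (induction \<gamma>s arbitrary: f) (simp_all add: inv_id_minus_deriv_id_minus_deriv)

text \<open>Reading coefficients from the top turns a factor \<open>z - \<gamma>\<close> into
  \<open>I - \<gamma> D\<close>. The coefficient recursion for \<open>[:- \<gamma>, 1:] * ?Q\<close>
  splits the sum into one for \<open>f\<close> and one for \<open>\<gamma> f'\<close>, which is the
  induction hypothesis at \<open>id_minus_deriv \<gamma> f\<close>; the head of the list thus acts
  first, hence \<open>rev\<close>.\<close>

lemma sum_coeff_higher_pderiv_factor: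
  "(\<Sum>k\<le>length \<gamma>s. smult (coeff (\<Prod>\<gamma>\<leftarrow>\<gamma>s. [:- \<gamma>, 1:]) (length \<gamma>s - k)) ((pderiv ^^ k) f))
    = foldr id_minus_deriv (rev \<gamma>s) f"
proof (induction \<gamma>s arbitrary: f)
  case (Cons \<gamma> \<gamma>s)
  let ?n = "length \<gamma>s" and ?Q = "\<Prod>\<gamma>\<leftarrow>\<gamma>s. [:- \<gamma>, 1:]"
  have "degree ?Q \<le> ?n"
  proof (induction \<gamma>s)
    case (Cons \<gamma> \<gamma>s)
    have "degree ([:- \<gamma>, 1:] * (\<Prod>\<gamma>\<leftarrow>\<gamma>s. [:- \<gamma>, 1:])) \<le> 1 + length \<gamma>s"
      by (rule order_trans[OF degree_mult_le]) (use Cons in auto)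
    then show ?case by simp
  qed simp
  then have Q0: "coeff ?Q (Suc ?n) = 0" by (intro coeff_eq_0) simp
  have c: "coeff ([:- \<gamma>, 1:] * ?Q) (Suc i) = coeff ?Q i - \<gamma> * coeff ?Q (Suc i)" for i by simp
  have c0: "coeff ([:- \<gamma>, 1:] * ?Q) 0 = - \<gamma> * coeff ?Q 0" by simp
  let ?t = "\<lambda>k. smult (coeff ?Q (?n - k)) ((pderiv ^^ k) f)"
  let ?u = "\<lambda>k. smult (\<gamma> * coeff ?Q (?n - k)) ((pderiv ^^ Suc k) f)"
  have "(\<Sum>k\<le>Suc ?n. smult (coeff ([:- \<gamma>, 1:] * ?Q) (Suc ?n - k)) ((pderiv ^^ k) f))
      = (\<Sum>k\<le>?n. smult (coeff ?Q (?n - k) - \<gamma> * coeff ?Q (Suc ?n - k)) ((pderiv ^^ k) f))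
        - ?u ?n"
  proof -
    have "coeff ([:- \<gamma>, 1:] * ?Q) (Suc ?n - k) = coeff ?Q (?n - k) - \<gamma> * coeff ?Q (Suc ?n - k)"
      if "k \<le> ?n" for k
      using c[of "?n - k"] that by (simp only: Suc_diff_le)
    moreover have "smult (coeff ([:- \<gamma>, 1:] * ?Q) (Suc ?n - Suc ?n)) ((pderiv ^^ Suc ?n) f) = - ?u ?n"
      unfolding diff_self_eq_0 c0 by (simp only: smult_minus_left mult_minus_left)
    ultimately show ?thesis
      unfolding sum.atMost_Suc diff_conv_add_uminus
      by (intro arg_cong2[where f = "(+)"] sum.cong refl) (simp_all only: atMost_iff diff_conv_add_uminus)
  qed
  also have "\<dots> = (\<Sum>k\<le>?n. ?t k)
      - ((\<Sum>k\<le>?n. smult (\<gamma> * coeff ?Q (Suc ?n - k)) ((pderiv ^^ k) f)) + ?u ?n)"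
    by (simp add: smult_diff_left sum_subtractf)
  also have "(\<Sum>k\<le>?n. smult (\<gamma> * coeff ?Q (Suc ?n - k)) ((pderiv ^^ k) f)) + ?u ?n
      = (\<Sum>k\<le>Suc ?n. smult (\<gamma> * coeff ?Q (Suc ?n - k)) ((pderiv ^^ k) f))"
    by simp
  \<comment> \<open>The index shift loses nothing, since the term \<open>k = 0\<close> carries
    \<open>coeff ?Q (Suc ?n) = 0\<close>.\<close>
  also have "\<dots> = (\<Sum>k\<le>?n. ?u k)"
    unfolding sum.atMost_Suc_shift using Q0 by simp
  also have "(\<Sum>k\<le>?n. ?t k) - (\<Sum>k\<le>?n. ?u k)
      = (\<Sum>k\<le>?n. smult (coeff ?Q (?n - k)) ((pderiv ^^ k) (id_minus_deriv \<gamma> f)))"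
    unfolding sum_subtractf[symmetric] id_minus_deriv_def
    by (intro sum.cong refl)
      (simp add: higher_pderiv_diff higher_pderiv_smult smult_diff_right funpow_swap1 mult_ac)
  finally show ?case by (simp add: Cons.IH)
qed simp

lemma Top_eq_fold:
  fixes n :: nat and a :: "nat \<Rightarrow> complex"
  assumes "a 0 \<noteq> 0"
  defines "Q \<equiv> \<Sum>k\<le>n. monom (a k) (n - k)"
  obtains \<gamma>s where "mset \<gamma>s = proots Q" "\<And>f. Top n a f = smult (a 0) (foldr id_minus_deriv \<gamma>s f)"
proof -
  have coeffQ: "coeff Q (n - k) = a k" if "k \<le> n" for k
  proof -
    have "coeff Q (n - k) = (\<Sum>j\<le>n. if n - j = n - k then a j else 0)"
      unfolding Q_def by (simp only: coeff_sum coeff_monom)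
    \<comment> \<open>Truncated subtraction is harmless: for \<open>j\<close> and \<open>k\<close>
      up to \<open>n\<close>, \<open>n - j = n - k\<close> forces \<open>j = k\<close>.\<close>
    also have "\<dots> = (\<Sum>j\<in>{k}. if n - j = n - k then a j else 0)"
      by (rule sum.mono_neutral_right) (use that in auto)
    finally show ?thesis by simp
  qed
  have "degree Q \<le> n"
    unfolding Q_def by (intro degree_sum_le) (auto intro: order_trans[OF degree_monom_le])
  moreover have "n \<le> degree Q" using coeffQ[of 0] assms(1) by (intro le_degree) simp
  ultimately have deg: "degree Q = n" by simp
  obtain \<gamma>s where \<gamma>s: "mset \<gamma>s = proots Q" using ex_mset by blast
  have len: "length \<gamma>s = n"
    using arg_cong[OF \<gamma>s, of size] by (simp add: size_proots_complex deg)
  have "(\<Prod>x\<in>#proots Q. [:- x, 1:]) = (\<Prod>x\<leftarrow>\<gamma>s. [:- x, 1:])"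
    by (simp add: \<gamma>s[symmetric] prod_mset_prod_list flip: mset_map)
  moreover have "lead_coeff Q = a 0" using coeffQ[of 0] by (simp add: deg)
  ultimately have prodQ: "smult (a 0) (\<Prod>x\<leftarrow>\<gamma>s. [:- x, 1:]) = Q"
    using complex_poly_decompose_multiset[of Q] by simp
  have a: "a k = a 0 * coeff (\<Prod>x\<leftarrow>\<gamma>s. [:- x, 1:]) (n - k)" if "k \<le> n" for k
    by (simp only: coeffQ[OF that, symmetric] prodQ[symmetric] coeff_smult)
  have "Top n a f = smult (a 0) (foldr id_minus_deriv (rev \<gamma>s) f)" for f
  proof -
    have "Top n a f = smult (a 0) (\<Sum>k\<le>n. smult (coeff (\<Prod>x\<leftarrow>\<gamma>s. [:- x, 1:]) (n - k)) ((pderiv ^^ k) f))"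
      unfolding Top_def smult_sum_right smult_smult
      by (intro sum.cong refl) (simp only: atMost_iff a[symmetric])
    then show ?thesis
      using sum_coeff_higher_pderiv_factor[of \<gamma>s f] by (simp only: len)
  qed
  then show ?thesis using that[of "rev \<gamma>s"] \<gamma>s by simp
qed

section \<open>From root displacements to the distances\<close>

lemma dh_le:
  assumes "finite A" "finite B" "A \<noteq> {}" "B \<noteq> {}"
    and "\<And>y. y \<in> B \<Longrightarrow> \<exists>x\<in>A. cmod (x - y) \<le> r"
  shows "dh A B \<le> ereal r"
proof -
  have "Min ((\<lambda>x. cmod (x - y)) ` A) \<le> r" if "y \<in> B" for y
    using assms(5)[OF that] assms(1,3) by (subst Min_le_iff) auto
  then have "Max ((\<lambda>y. Min ((\<lambda>x. cmod (x - y)) ` A)) ` B) \<le> r"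
    using assms(2,4) by (subst Max_le_iff) auto
  moreover have "A \<noteq> UNIV" "B \<noteq> UNIV" using assms(1,2) infinite_UNIV_char_0 by auto
  ultimately show ?thesis using assms(3,4) by (simp add: dh_def)
qed

text \<open>\<open>dF\<close> uses an unspecified enumeration of \<open>U\<close>, so a good partner
  is demanded for every enumeration; \<open>m \<ge> 1\<close> keeps the inner \<open>Max\<close>
  over a nonempty set.\<close>

lemma dF_le:
  assumes "size U = m" "m \<ge> 1"
    and "\<And>us. mset us = U \<Longrightarrow> \<exists>vs. mset vs = V \<and> (\<forall>k<m. cmod (us ! k - vs ! k) \<le> r)"
  shows "dF U V \<le> r"
proof -
  define us where "us = (SOME us. mset us = U)"
  have "mset us = U" unfolding us_def by (rule someI_ex) (rule ex_mset)
  then obtain vs where vs: "mset vs = V" "\<forall>k<m. cmod (us ! k - vs ! k) \<le> r"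
    using assms(3) by blast
  let ?d = "\<lambda>vs. Max ((\<lambda>k. cmod (us ! k - vs ! k)) ` {..<m})"
  have "{?d vs | vs. mset vs = V} = ?d ` {vs. mset vs = V}" by auto
  moreover have "finite {vs. mset vs = V}" using mset_eq_finite[of vs] vs(1) by simp
  ultimately have "finite {?d vs | vs. mset vs = V}" by simp
  then have "Min {?d vs | vs. mset vs = V} \<le> ?d vs" using vs(1) by (intro Min_le) auto
  also have "\<dots> \<le> r" using vs(2) assms(2) by (subst Max_le_iff) (auto simp: lessThan_empty_iff)
  finally show ?thesis unfolding dF_def Let_def us_def[symmetric] assms(1) .
qed

text \<open>\<open>?P\<close> runs from \<open>f\<close> to \<open>g\<close> by scaled factors and
  \<open>?R\<close> from \<open>g\<close> back to \<open>f\<close> by scaled inverse factors. Both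
  displace roots by at most \<open>?S\<close>, and the matching costs one more factor
  \<open>degree f\<close>.\<close>

lemma dF_foldr_id_minus_deriv_le:
  assumes "degree f \<ge> 1" and g: "g = foldr id_minus_deriv \<gamma>s f"
  shows "dF (proots f) (proots g) \<le> real (degree f) * (real (degree f) * (\<Sum>\<gamma>\<leftarrow>\<gamma>s. cmod \<gamma>))"
proof (rule dF_le)
  let ?m = "degree f" and ?S = "real (degree f) * (\<Sum>\<gamma>\<leftarrow>\<gamma>s. cmod \<gamma>)"
  fix us assume us: "mset us = proots f"
  obtain ys where ys: "mset ys = proots g" using ex_mset by blast
  have degg: "degree g = ?m" by (simp add: g fwd.degree_fold)
  have ly: "length ys = ?m"
    using arg_cong[OF ys, of size] by (simp add: size_proots_complex degg)
  let ?P = "\<lambda>t. foldr id_minus_deriv (map ((*) (complex_of_real t)) \<gamma>s) f"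
  let ?R = "\<lambda>t. foldr inv_id_minus_deriv (map ((*) (complex_of_real t)) (rev \<gamma>s)) g"
  have one: "map ((*) (complex_of_real 1)) \<delta>s = \<delta>s" for \<delta>s by (simp add: map_idI)
  have P0: "foldr id_minus_deriv (map ((*) (complex_of_real 0)) \<delta>s) q = q" for \<delta>s q
    by (induction \<delta>s) (simp_all add: fwd.h_0)
  have R0: "foldr inv_id_minus_deriv (map ((*) (complex_of_real 0)) \<delta>s) q = q" for \<delta>s q
    by (induction \<delta>s) simp_all
  have R1: "?R 1 = f"
    unfolding one g using foldr_inv_id_minus_deriv_fold[of "rev \<gamma>s" f] by simp
  have P: "root_path ?m ?S ?P" by (rule fwd.root_path_fold[OF assms(1)])
  have R: "root_path ?m ?S ?R"
    using bwd.root_path_fold[of g "rev \<gamma>s"] assms(1)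
    unfolding degg rev_map[symmetric] sum_list_rev by simp
  have S: "?S \<ge> 0" by (auto intro!: mult_nonneg_nonneg sum_list_nonneg)
  obtain \<sigma> where \<sigma>: "bij_betw \<sigma> {..<?m} {..<?m}"
    "\<And>i. i < ?m \<Longrightarrow> cmod (us ! i - ys ! \<sigma> i) \<le> real ?m * ?S"
  proof (rule root_paths_matching[OF P R S])
    show "proots (?P 0) = mset us" unfolding P0 using us by simp
    show "proots (?P 1) = mset ys" unfolding one using ys g by simp
    show "proots (?R 0) = mset ys" unfolding R0 using ys by simp
    show "proots (?R 1) = mset us" unfolding R1 using us by simp
  qed blast
  \<comment> \<open>The roots of \<open>g\<close> are relisted in the order of their partners in
    \<open>us\<close>.\<close>
  define vs where "vs = map (\<lambda>i. ys ! \<sigma> i) [0..<?m]"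
  have "mset vs = image_mset (\<lambda>i. ys ! i) (image_mset \<sigma> (mset_set {..<?m}))"
    by (simp add: vs_def atLeast0LessThan image_mset.compositionality o_def flip: mset_set_upto_eq_mset_upto)
  also have "image_mset \<sigma> (mset_set {..<?m}) = mset_set {..<?m}"
    using \<sigma>(1) by (simp add: image_mset_mset_set bij_betw_def)
  also have "image_mset (\<lambda>i. ys ! i) (mset_set {..<?m}) = mset (map (\<lambda>i. ys ! i) [0..<length ys])"
    by (simp add: ly atLeast0LessThan flip: mset_set_upto_eq_mset_upto)
  also have "\<dots> = proots g" by (simp add: map_nth ys)
  finally have "mset vs = proots g" .
  moreover have "\<forall>k<?m. cmod (us ! k - vs ! k) \<le> real ?m * ?S"
    using \<sigma>(2) by (simp add: vs_def)
  ultimately show "\<exists>vs. mset vs = proots g \<and> (\<forall>k<?m. cmod (us ! k - vs ! k) \<le> real ?m * ?S)"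
    by blast
qed (use assms(1) in \<open>simp_all add: size_proots_complex\<close>)

theorem mainTheorem3:
  fixes n :: nat and a :: "nat \<Rightarrow> complex"
  assumes "n \<ge> 1" and "a 0 \<noteq> 0"
  defines "Q \<equiv> (\<Sum>k\<le>n. monom (a k) (n - k))"
  shows "(\<forall>f. degree f \<le> n \<longrightarrow> degree (Top n a f) = degree f)
    \<and> Kh n (Top n a) \<le> ereal (real n * (\<Sum>\<gamma>\<in>#proots Q. cmod \<gamma>))
    \<and> KH n (Top n a) \<le> ereal (real n * (\<Sum>\<gamma>\<in>#proots Q. cmod \<gamma>))
    \<and> KF n (Top n a) \<le> ereal (real n ^ 2 * (\<Sum>\<gamma>\<in>#proots Q. cmod \<gamma>))"
proof -
  obtain \<gamma>s where \<gamma>s: "mset \<gamma>s = proots Q"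
    and T: "\<And>f. Top n a f = smult (a 0) (foldr id_minus_deriv \<gamma>s f)"
    using Top_eq_fold[where a = a and n = n, OF assms(2)] unfolding Q_def by blast
  define \<Gamma> where "\<Gamma> = (\<Sum>\<gamma>\<leftarrow>\<gamma>s. cmod \<gamma>)"
  have sumQ: "(\<Sum>\<gamma>\<in>#proots Q. cmod \<gamma>) = \<Gamma>"
    unfolding \<Gamma>_def \<gamma>s[symmetric] by (simp add: sum_mset_sum_list flip: mset_map)
  have \<Gamma>: "\<Gamma> \<ge> 0" unfolding \<Gamma>_def by (auto intro!: sum_list_nonneg)
  have degT: "degree (Top n a f) = degree f" for f
    using assms(2) by (simp add: T fwd.degree_fold)
  have ZT: "Zset (Top n a f) = Zset (foldr id_minus_deriv \<gamma>s f)" for f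
    using assms(2) by (simp add: T Zset_def)
  have both: "dh (Zset f) (Zset (Top n a f)) \<le> ereal (real n * \<Gamma>) \<and>
      dh (Zset (Top n a f)) (Zset f) \<le> ereal (real n * \<Gamma>)" if f: "degree f \<le> n" for f
  proof -
    define g where "g = foldr id_minus_deriv \<gamma>s f"
    have degg: "degree g = degree f" by (simp add: g_def fwd.degree_fold)
    have nonneg: "0 \<le> ereal (real n * \<Gamma>)" using \<Gamma> by simp
    have lc: "coeff g (degree f) = lead_coeff f" by (simp add: g_def fwd.lead_coeff_fold)
    consider "degree f \<ge> 1" | "f = 0" | "degree f = 0" "f \<noteq> 0" by linarith
    then have "dh (Zset f) (Zset g) \<le> ereal (real n * \<Gamma>) \<and> dh (Zset g) (Zset f) \<le> ereal (real n * \<Gamma>)"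
    proof cases
      case 1
      have fg: "f \<noteq> 0" "g \<noteq> 0" using 1 degg by auto
      have fin: "finite (Zset f)" "finite (Zset g)"
        using fg by (simp_all add: Zset_def poly_roots_finite)
      have "\<exists>z. poly p z = 0" if "degree p \<ge> 1" for p :: "complex poly"
        using that by (intro fundamental_theorem_of_algebra) (simp add: constant_degree)
      then have ne: "Zset f \<noteq> {}" "Zset g \<noteq> {}" using 1 degg by (auto simp: Zset_def)
      have "real (degree f) * \<Gamma> \<le> real n * \<Gamma>" using f \<Gamma> by (intro mult_right_mono) auto
      moreover have "\<exists>x\<in>Zset f. cmod (x - y) \<le> real (degree f) * \<Gamma>" if "y \<in> Zset g" for y
        using fwd.root_fold[OF 1, of \<gamma>s y] that by (auto simp: Zset_def g_def \<Gamma>_def)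
      moreover have "\<exists>y\<in>Zset g. cmod (y - x) \<le> real (degree f) * \<Gamma>" if "x \<in> Zset f" for x
      proof -
        \<comment> \<open>The opposite one-sided bound comes from recovering \<open>f\<close> from
          \<open>g\<close> by the inverse factors, whose parameters have the same moduli.\<close>
        have "foldr inv_id_minus_deriv (rev \<gamma>s) g = f"
          using foldr_inv_id_minus_deriv_fold[of "rev \<gamma>s" f] by (simp add: g_def)
        then show ?thesis
          using bwd.root_fold[of g "rev \<gamma>s" x] that 1 degg
          by (auto simp: Zset_def \<Gamma>_def sum_list_rev simp flip: rev_map)
      qed
      ultimately show ?thesis
        by (intro conjI dh_le fin ne) (meson order_trans)+
    next
      case 2
      \<comment> \<open>Both zero sets are the whole plane, where \<open>dh\<close> is 0 by
        convention.\<close>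
      have "id_minus_deriv \<gamma> 0 = 0" for \<gamma> by simp
      then have "g = 0" unfolding g_def 2 by (induction \<gamma>s) simp_all
      then show ?thesis using 2 nonneg by (simp add: Zset_def dh_def)
    next
      case 3
      \<comment> \<open>Both polynomials are nonzero constants, so both zero sets are empty and
        \<open>dh\<close> is again 0 by convention.\<close>
      then have "coeff g (degree f) \<noteq> 0" unfolding lc leading_coeff_0_iff by simp
      then have "g \<noteq> 0" by auto
      then have "Zset f = {}" "Zset g = {}" using 3 degg
        by (auto simp: Zset_def elim!: degree_eq_zeroE)
      then show ?thesis using nonneg by (simp add: dh_def)
    qed
    then show ?thesis by (simp add: ZT g_def)
  qed
  have "dF (proots f) (proots (Top n a f)) \<le> real n ^ 2 * \<Gamma>"
    if f: "degree f \<le> n" "degree f \<ge> 1" for f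
  proof -
    have "proots (Top n a f) = proots (foldr id_minus_deriv \<gamma>s f)"
      unfolding T using assms(2) by simp
    then have "dF (proots f) (proots (Top n a f)) \<le> real (degree f) * (real (degree f) * \<Gamma>)"
      unfolding \<Gamma>_def using dF_foldr_id_minus_deriv_le[OF f(2) refl, of \<gamma>s] by simp
    also have "\<dots> \<le> real n * (real n * \<Gamma>)" using f \<Gamma> by (intro mult_mono) auto
    finally show ?thesis by (simp add: power2_eq_square)
  qed
  then show ?thesis
    unfolding sumQ Kh_def KH_def KF_def dHH_def using degT both by (auto intro!: SUP_least)
qed

end
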